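(* Let $k\ge 0$, let $\Gamma$ be a $1$-graph, and let $F : \Gamma \to \mathcal{M}_k$ be a functor. Then there is, up to isomorphism of $\Gamma$-systems, exactly one $\Gamma$-system $X$ of $k$-morphs such that $F(\gamma) = [X_\gamma]$ for all $\gamma \in \Gamma$.
   Context: **$k$-graphs.** Let $k\ge 0$ ($\mathbb{N}^0=\{0\}$). A $k$-graph is a nonempty countable small category $\Lambda$ with a functor $d:\Lambda\to\mathbb{N}^k$ satisfying the factorisation property: whenever $d(\lambda)=m+n$ there are unique $\mu,\nu\in\Lambda$ with $d(\mu)=m$, $d(\nu)=n$ and $\lambda=\mu\nu$. Objects are identified with $\Lambda^0=d^{-1}(0)$; $r,s$ are the codomain and domain maps. Isomorphisms of $k$-graphs are degree-preserving isomorphisms of categories. **$k$-morphs.** A $\Lambda$--$\Gamma$ morph is a countable set $X$ with maps $r:X\to\Lambda^0$, $s:X\to\Gamma^0$ and a bijection $\phi: X*_{\Gamma^0}\Gamma\to\Lambda*_{\Lambda^0}X$, where $X*_{\Gamma^0}\Gamma=\{(x,\gamma): s(x)=r(\gamma)\}$ and $\Lambda*_{\Lambda^0}X=\{(\lambda,x): s(\lambda)=r(x)\}$, such that whenever $\phi(x_1,\gamma_1)=(\lambda_1,x_2)$: (1) $d(\gamma_1)=d(\lambda_1)$; (2) $s(\gamma_1)=s(x_2)$; (3) $r(\lambda_1)=r(x_1)$; and (4) if also $\phi(x_2,\gamma_2)=(\lambda_2,x_3)$, then $\phi(x_1,\gamma_1\gamma_2)=(\lambda_1\lambda_2,x_3)$.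 An isomorphism of $\Lambda$--$\Gamma$ morphs is a bijection $\theta:X\to Y$ intertwining $r$ and $s$ with $(\operatorname{id}_\Lambda\times\theta)\circ\phi_X=\phi_Y\circ(\theta\times\operatorname{id}_\Gamma)$; $[X]$ is the isomorphism class. $I_\Lambda$ is the $\Lambda$--$\Lambda$ morph $\Lambda^0$ with $r=s=\operatorname{id}$ and $\phi(r(\lambda),\lambda)=(\lambda,s(\lambda))$. If $X_i$ is a $\Lambda_{i-1}$--$\Lambda_i$ morph ($i=1,2$), then $X_1*_{\Lambda_1^0}X_2=\{(x_1,x_2): s(x_1)=r(x_2)\}$ is a $\Lambda_0$--$\Lambda_2$ morph with $r(x_1,x_2)=r(x_1)$, $s(x_1,x_2)=s(x_2)$, $\phi((x_1,x_2),\lambda_2)=(\lambda_0,(x_1',x_2'))$ where $\phi_2(x_2,\lambda_2)=(\lambda_1,x_2')$ and $\phi_1(x_1,\lambda_1)=(\lambda_0,x_1')$. **The category $\mathcal{M}_k$.** Objects are $k$-graphs; $\operatorname{Hom}_{\mathcal{M}_k}(\Gamma,\Lambda)$ is the set of isomorphism classes of $\Lambda$--$\Gamma$ morphs; identities are $[I_\Lambda]$; composition is $[X_1][X_2]=[X_1*_{\Lambda_1^0}X_2]$. **$\Gamma$-systems.** Let $\Gamma$ be an $l$-graph. A $\Gamma$-system $X$ of $k$-morphs (with data $\Lambda,\theta$) consists of a $k$-graph $\Lambda_v$ for each $v\in\Gamma^0$, a $\Lambda_{r(\gamma)}$--$\Lambda_{s(\gamma)}$ morph $X_\gamma$ for each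 $\gamma\in\Gamma$, and an isomorphism $\theta_{\alpha,\beta}:X_\alpha*_{\Lambda^0_{s(\alpha)}}X_\beta\to X_{\alpha\beta}$ for each composable pair, such that (1) $X_v=I_{\Lambda_v}$ for $v\in\Gamma^0$; (2) $\theta_{r(\gamma),\gamma}(r(x),x)=x$ and $\theta_{\gamma,s(\gamma)}(x,s(x))=x$ for $x\in X_\gamma$; (3) $\theta_{\alpha\beta,\gamma}\circ(\theta_{\alpha,\beta}\times\operatorname{id}_{X_\gamma})=\theta_{\alpha,\beta\gamma}\circ(\operatorname{id}_{X_\alpha}\times\theta_{\beta,\gamma})$ on $X_\alpha*X_\beta*X_\gamma$ for each composable triple. The equality $F(\gamma)=[X_\gamma]$ is an equality of morphisms in $\mathcal{M}_k$; in particular the object map of $F$ satisfies $F^0(v)=\Lambda_v$ for $v\in\Gamma^0$. An isomorphism from a $\Gamma$-system $(\Lambda,X,\theta)$ to $(\Xi,Y,\psi)$ consists of $k$-graph isomorphisms $h^0_v:\Lambda_v\to\Xi_v$ ($v\in\Gamma^0$) and bijections $h_\gamma:X_\gamma\to Y_\gamma$ ($\gamma\in\Gamma$) with $s\circ h_\gamma=h^0_{s(\gamma)}\circ s$, $r\circ h_\gamma=h^0_{r(\gamma)}\circ r$, $(h^0_{r(\gamma)}\times h_\gamma)\circ\phi_{X_\gamma}=\phi_{Y_\gamma}\circ(h_\gamma\times h^0_{s(\gamma)})$, and $h_{\alpha\beta}\circ\theta_{\alpha,\beta}=\psi_{\alpha,\beta}\circ(h_\alpha\times h_\beta)$ for composable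 $\alpha,\beta$. *)

theory Defs
  imports
    "HOL-Library.FuncSet"
    "HOL-Library.Countable_Set"
    "HOL-Library.Function_Algebras"
begin

section \<open>Small categories and functors\<close>

record ('o, 'a) cat =
  Obj :: "'o set"
  Arr :: "'a set"
  Dom :: "'a \<Rightarrow> 'o"
  Cod :: "'a \<Rightarrow> 'o"
  Id :: "'o \<Rightarrow> 'a"
  Cmp :: "'a \<Rightarrow> 'a \<Rightarrow> 'a"

definition category :: "('o, 'a) cat \<Rightarrow> bool" where
  "category C \<longleftrightarrow>
     (\<forall>f\<in>Arr C. Dom C f \<in> Obj C \<and> Cod C f \<in> Obj C) \<and>
     (\<forall>x\<in>Obj C. Id C x \<in> Arr C \<and> Dom C (Id C x) = x \<and> Cod C (Id C x) = x) \<and>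
     (\<forall>f\<in>Arr C. \<forall>g\<in>Arr C. Dom C f = Cod C g \<longrightarrow>
        Cmp C f g \<in> Arr C \<and> Dom C (Cmp C f g) = Dom C g \<and> Cod C (Cmp C f g) = Cod C f) \<and>
     (\<forall>f\<in>Arr C. Cmp C (Id C (Cod C f)) f = f \<and> Cmp C f (Id C (Dom C f)) = f) \<and>
     (\<forall>f\<in>Arr C. \<forall>g\<in>Arr C. \<forall>h\<in>Arr C. Dom C f = Cod C g \<and> Dom C g = Cod C h \<longrightarrow>
        Cmp C (Cmp C f g) h = Cmp C f (Cmp C g h))"

definition is_functor ::
  "('o, 'a) cat \<Rightarrow> ('p, 'b) cat \<Rightarrow> ('o \<Rightarrow> 'p) \<Rightarrow> ('a \<Rightarrow> 'b) \<Rightarrow> bool" where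
  "is_functor C D F0 F \<longleftrightarrow>
     (\<forall>x\<in>Obj C. F0 x \<in> Obj D) \<and>
     (\<forall>f\<in>Arr C. F f \<in> Arr D \<and> Dom D (F f) = F0 (Dom C f) \<and> Cod D (F f) = F0 (Cod C f)) \<and>
     (\<forall>x\<in>Obj C. F (Id C x) = Id D (F0 x)) \<and>
     (\<forall>f\<in>Arr C. \<forall>g\<in>Arr C. Dom C f = Cod C g \<longrightarrow> F (Cmp C f g) = Cmp D (F f) (F g))"

definition is_category_iso ::
  "('o, 'a) cat \<Rightarrow> ('p, 'b) cat \<Rightarrow> ('o \<Rightarrow> 'p) \<Rightarrow> ('a \<Rightarrow> 'b) \<Rightarrow> bool" where
  "is_category_iso C D F0 F \<longleftrightarrow>
     is_functor C D F0 F \<and> bij_betw F0 (Obj C) (Obj D) \<and> bij_betw F (Arr C) (Arr D)"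

definition fprod :: "'x set \<Rightarrow> ('x \<Rightarrow> 'c) \<Rightarrow> 'y set \<Rightarrow> ('y \<Rightarrow> 'c) \<Rightarrow> ('x \<times> 'y) set" where
  "fprod A f B g = {(a, b). a \<in> A \<and> b \<in> B \<and> f a = g b}"


section \<open>Higher-rank graphs\<close>

text \<open>
  The monoid \<open>\<nat>\<^sup>k\<close> (including \<open>k = 0\<close>): functions supported below \<open>k\<close>, with the pointwise
  addition of \<^theory>\<open>HOL-Library.Function_Algebras\<close>.
\<close>

definition NN :: "nat \<Rightarrow> (nat \<Rightarrow> nat) set" where
  "NN k = {n. \<forall>i\<ge>k. n i = 0}"

record 'a kgraph =
  paths :: "'a set"
  rng :: "'a \<Rightarrow> 'a"
  src :: "'a \<Rightarrow> 'a"
  cmp :: "'a \<Rightarrow> 'a \<Rightarrow> 'a"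
  deg :: "'a \<Rightarrow> nat \<Rightarrow> nat"

definition verts :: "'a kgraph \<Rightarrow> 'a set" where
  "verts \<Lambda> = {v \<in> paths \<Lambda>. deg \<Lambda> v = 0}"

text \<open>The underlying category, whose objects are identified with the paths of degree zero.\<close>

definition kcat :: "'a kgraph \<Rightarrow> ('a, 'a) cat" where
  "kcat \<Lambda> = \<lparr>Obj = verts \<Lambda>, Arr = paths \<Lambda>, Dom = src \<Lambda>, Cod = rng \<Lambda>,
     Id = (\<lambda>v. v), Cmp = cmp \<Lambda>\<rparr>"

text \<open>
  All structure maps, here and for morphs below, are required to be extensional (equal to
  \<^const>\<open>undefined\<close> outside their domain), so that equality of records is equality of the
  structures they encode.  This matters for \<open>X\<^sub>v = I\<close>, for \<open>F(\<gamma>) = [X\<^sub>\<gamma>]\<close>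
  and for \<open>k\<close>-graphs as objects of a category.
\<close>

definition is_kgraph :: "nat \<Rightarrow> 'a kgraph \<Rightarrow> bool" where
  "is_kgraph k \<Lambda> \<longleftrightarrow>
     paths \<Lambda> \<noteq> {} \<and> countable (paths \<Lambda>) \<and>
     rng \<Lambda> \<in> extensional (paths \<Lambda>) \<and>
     src \<Lambda> \<in> extensional (paths \<Lambda>) \<and>
     (\<forall>\<mu> \<nu>. (\<mu>, \<nu>) \<notin> fprod (paths \<Lambda>) (src \<Lambda>) (paths \<Lambda>) (rng \<Lambda>) \<longrightarrow> cmp \<Lambda> \<mu> \<nu> = undefined) \<and>
     category (kcat \<Lambda>) \<and>
     deg \<Lambda> \<in> paths \<Lambda> \<rightarrow>\<^sub>E NN k \<and>
     (\<forall>(\<mu>, \<nu>) \<in> fprod (paths \<Lambda>) (src \<Lambda>) (paths \<Lambda>) (rng \<Lambda>).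
        deg \<Lambda> (cmp \<Lambda> \<mu> \<nu>) = deg \<Lambda> \<mu> + deg \<Lambda> \<nu>) \<and>
     (\<forall>l\<in>paths \<Lambda>. \<forall>m\<in>NN k. \<forall>n\<in>NN k. deg \<Lambda> l = m + n \<longrightarrow>
        (\<exists>!p. p \<in> fprod (paths \<Lambda>) (src \<Lambda>) (paths \<Lambda>) (rng \<Lambda>) \<and>
              deg \<Lambda> (fst p) = m \<and> deg \<Lambda> (snd p) = n \<and> l = cmp \<Lambda> (fst p) (snd p)))"

definition is_kgraph_iso :: "'a kgraph \<Rightarrow> 'b kgraph \<Rightarrow> ('a \<Rightarrow> 'b) \<Rightarrow> bool" where
  "is_kgraph_iso \<Lambda> \<Xi> h \<longleftrightarrow>
     is_category_iso (kcat \<Lambda>) (kcat \<Xi>) h h \<and> (\<forall>l\<in>paths \<Lambda>. deg \<Xi> (h l) = deg \<Lambda> l)"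


section \<open>Morphs\<close>

record ('a, 'b, 'x) morph =
  elts :: "'x set"
  mrng :: "'x \<Rightarrow> 'a"
  msrc :: "'x \<Rightarrow> 'b"
  phi :: "'x \<times> 'b \<Rightarrow> 'a \<times> 'x"

abbreviation phi_dom :: "'b kgraph \<Rightarrow> ('a, 'b, 'x) morph \<Rightarrow> ('x \<times> 'b) set" where
  "phi_dom \<Gamma> X \<equiv> fprod (elts X) (msrc X) (paths \<Gamma>) (rng \<Gamma>)"

abbreviation phi_cod :: "'a kgraph \<Rightarrow> ('a, 'b, 'x) morph \<Rightarrow> ('a \<times> 'x) set" where
  "phi_cod \<Lambda> X \<equiv> fprod (paths \<Lambda>) (src \<Lambda>) (elts X) (mrng X)"

definition is_morph :: "'a kgraph \<Rightarrow> 'b kgraph \<Rightarrow> ('a, 'b, 'x) morph \<Rightarrow> bool" where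
  "is_morph \<Lambda> \<Gamma> X \<longleftrightarrow>
     countable (elts X) \<and>
     mrng X \<in> elts X \<rightarrow>\<^sub>E verts \<Lambda> \<and>
     msrc X \<in> elts X \<rightarrow>\<^sub>E verts \<Gamma> \<and>
     phi X \<in> extensional (phi_dom \<Gamma> X) \<and>
     bij_betw (phi X) (phi_dom \<Gamma> X) (phi_cod \<Lambda> X) \<and>
     (\<forall>x1 g1 l1 x2. (x1, g1) \<in> phi_dom \<Gamma> X \<and> phi X (x1, g1) = (l1, x2) \<longrightarrow>
        deg \<Gamma> g1 = deg \<Lambda> l1 \<and>
        src \<Gamma> g1 = msrc X x2 \<and>
        rng \<Lambda> l1 = mrng X x1 \<and>
        (\<forall>g2 l2 x3. (x2, g2) \<in> phi_dom \<Gamma> X \<and> phi X (x2, g2) = (l2, x3) \<longrightarrow>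
           phi X (x1, cmp \<Gamma> g1 g2) = (cmp \<Lambda> l1 l2, x3)))"

definition is_morph_iso ::
  "'a kgraph \<Rightarrow> 'b kgraph \<Rightarrow> ('a, 'b, 'x) morph \<Rightarrow> ('a, 'b, 'y) morph \<Rightarrow> ('x \<Rightarrow> 'y) \<Rightarrow> bool" where
  "is_morph_iso \<Lambda> \<Gamma> X Y \<theta> \<longleftrightarrow>
     is_morph \<Lambda> \<Gamma> X \<and> is_morph \<Lambda> \<Gamma> Y \<and>
     bij_betw \<theta> (elts X) (elts Y) \<and>
     (\<forall>x\<in>elts X. mrng Y (\<theta> x) = mrng X x \<and> msrc Y (\<theta> x) = msrc X x) \<and>
     (\<forall>p\<in>phi_dom \<Gamma> X. map_prod id \<theta> (phi X p) = phi Y (map_prod \<theta> id p))"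

definition morph_isomorphic ::
  "'a kgraph \<Rightarrow> 'b kgraph \<Rightarrow> ('a, 'b, 'x) morph \<Rightarrow> ('a, 'b, 'y) morph \<Rightarrow> bool" where
  "morph_isomorphic \<Lambda> \<Gamma> X Y \<longleftrightarrow> (\<exists>\<theta>. is_morph_iso \<Lambda> \<Gamma> X Y \<theta>)"

definition id_morph :: "'a kgraph \<Rightarrow> ('a, 'a, 'a) morph" where
  "id_morph \<Lambda> = \<lparr>elts = verts \<Lambda>,
     mrng = restrict id (verts \<Lambda>),
     msrc = restrict id (verts \<Lambda>),
     phi = restrict (\<lambda>(v, l). (l, src \<Lambda> l)) (fprod (verts \<Lambda>) id (paths \<Lambda>) (rng \<Lambda>))\<rparr>"

text \<open>
  The morph \<open>X\<^sub>1 * X\<^sub>2\<close>; the \<open>k\<close>-graph \<open>\<Lambda>2\<close> on its right is only needed to delimit the domain of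
  its bijection.
\<close>

definition comp_morph ::
  "'c kgraph \<Rightarrow> ('a, 'b, 'x) morph \<Rightarrow> ('b, 'c, 'y) morph \<Rightarrow> ('a, 'c, 'x \<times> 'y) morph" where
  "comp_morph \<Lambda>2 X1 X2 =
     (let E = fprod (elts X1) (msrc X1) (elts X2) (mrng X2);
          s = restrict (\<lambda>(x1, x2). msrc X2 x2) E
      in \<lparr>elts = E,
          mrng = restrict (\<lambda>(x1, x2). mrng X1 x1) E,
          msrc = s,
          phi = restrict (\<lambda>((x1, x2), l2).
                  let (l1, x2') = phi X2 (x2, l2); (l0, x1') = phi X1 (x1, l1)
                  in (l0, (x1', x2')))
                (fprod E s (paths \<Lambda>2) (rng \<Lambda>2))\<rparr>)"


section \<open>The category of \<open>k\<close>-graphs and isomorphism classes of morphs\<close>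

text \<open>
  The type \<open>'u\<close> is a universe: objects are the \<open>k\<close>-graphs whose paths lie in \<open>'u\<close>, and isomorphism
  classes are formed within the morphs whose elements lie in \<open>'u\<close>.  One type serves for both, as
  \<open>X\<^sub>v = I\<close> has the vertices of a \<open>k\<close>-graph as its elements.  By countability, when
  \<open>'u\<close> is infinite every morph between such \<open>k\<close>-graphs, whatever the type of its elements, is
  represented in its class.  (For finite \<open>'u\<close> a composite class may be empty; it is then not an
  arrow, so \<^const>\<open>is_functor\<close> rules it out as a value of a functor.)  An arrow records its codomain and domain, because the
  maps of a morph alone do not determine the \<open>k\<close>-graphs it goes between.
\<close>

datatype 'u mor = Mor (mcod: "'u kgraph") (mdom: "'u kgraph") (mcls: "('u, 'u, 'u) morph set")

definition mclass :: "'u kgraph \<Rightarrow> 'u kgraph \<Rightarrow> ('u, 'u, 'x) morph \<Rightarrow> 'u mor" where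
  "mclass \<Lambda> \<Gamma> X = Mor \<Lambda> \<Gamma> {Y. morph_isomorphic \<Lambda> \<Gamma> X Y}"

definition MHom :: "'u kgraph \<Rightarrow> 'u kgraph \<Rightarrow> 'u mor set" where
  "MHom \<Gamma> \<Lambda> = {mclass \<Lambda> \<Gamma> X | X :: ('u, 'u, 'u) morph. is_morph \<Lambda> \<Gamma> X}"

definition mcomp :: "'u mor \<Rightarrow> 'u mor \<Rightarrow> 'u mor" where
  "mcomp a b = Mor (mcod a) (mdom b)
     {Z. \<exists>X\<in>mcls a. \<exists>Y\<in>mcls b. morph_isomorphic (mcod a) (mdom b) (comp_morph (mdom b) X Y) Z}"

definition Mcat :: "nat \<Rightarrow> ('u kgraph, 'u mor) cat" where
  "Mcat k = \<lparr>Obj = {\<Lambda>. is_kgraph k \<Lambda>},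
     Arr = {a. \<exists>\<Lambda> \<Gamma>. is_kgraph k \<Lambda> \<and> is_kgraph k \<Gamma> \<and> a \<in> MHom \<Gamma> \<Lambda>},
     Dom = mdom, Cod = mcod,
     Id = (\<lambda>\<Lambda>. mclass \<Lambda> \<Lambda> (id_morph \<Lambda>)), Cmp = mcomp\<rparr>"


section \<open>Systems of \<open>k\<close>-morphs\<close>

definition is_system ::
  "nat \<Rightarrow> nat \<Rightarrow> 'g kgraph \<Rightarrow> ('g \<Rightarrow> 'u kgraph) \<Rightarrow> ('g \<Rightarrow> ('u, 'u, 'u) morph) \<Rightarrow>
     ('g \<Rightarrow> 'g \<Rightarrow> 'u \<times> 'u \<Rightarrow> 'u) \<Rightarrow> bool" where
  "is_system l k \<Gamma> \<Lambda> X \<theta> \<longleftrightarrow>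
     is_kgraph l \<Gamma> \<and>
     (\<forall>v\<in>verts \<Gamma>. is_kgraph k (\<Lambda> v)) \<and>
     (\<forall>g\<in>paths \<Gamma>. is_morph (\<Lambda> (rng \<Gamma> g)) (\<Lambda> (src \<Gamma> g)) (X g)) \<and>
     (\<forall>a\<in>paths \<Gamma>. \<forall>b\<in>paths \<Gamma>. src \<Gamma> a = rng \<Gamma> b \<longrightarrow>
        is_morph_iso (\<Lambda> (rng \<Gamma> a)) (\<Lambda> (src \<Gamma> b))
          (comp_morph (\<Lambda> (src \<Gamma> b)) (X a) (X b)) (X (cmp \<Gamma> a b)) (\<theta> a b)) \<and>
     (\<forall>v\<in>verts \<Gamma>. X v = id_morph (\<Lambda> v)) \<and>
     (\<forall>g\<in>paths \<Gamma>. \<forall>x\<in>elts (X g).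
        \<theta> (rng \<Gamma> g) g (mrng (X g) x, x) = x \<and>
        \<theta> g (src \<Gamma> g) (x, msrc (X g) x) = x) \<and>
     (\<forall>a\<in>paths \<Gamma>. \<forall>b\<in>paths \<Gamma>. \<forall>c\<in>paths \<Gamma>. src \<Gamma> a = rng \<Gamma> b \<and> src \<Gamma> b = rng \<Gamma> c \<longrightarrow>
        (\<forall>x\<in>elts (X a). \<forall>y\<in>elts (X b). \<forall>z\<in>elts (X c).
           msrc (X a) x = mrng (X b) y \<and> msrc (X b) y = mrng (X c) z \<longrightarrow>
           \<theta> (cmp \<Gamma> a b) c (\<theta> a b (x, y), z) = \<theta> a (cmp \<Gamma> b c) (x, \<theta> b c (y, z))))"

definition is_system_iso ::
  "'g kgraph \<Rightarrow>
     ('g \<Rightarrow> 'u kgraph) \<Rightarrow> ('g \<Rightarrow> ('u, 'u, 'u) morph) \<Rightarrow> ('g \<Rightarrow> 'g \<Rightarrow> 'u \<times> 'u \<Rightarrow> 'u) \<Rightarrow>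
     ('g \<Rightarrow> 'w kgraph) \<Rightarrow> ('g \<Rightarrow> ('w, 'w, 'w) morph) \<Rightarrow> ('g \<Rightarrow> 'g \<Rightarrow> 'w \<times> 'w \<Rightarrow> 'w) \<Rightarrow>
     ('g \<Rightarrow> 'u \<Rightarrow> 'w) \<Rightarrow> ('g \<Rightarrow> 'u \<Rightarrow> 'w) \<Rightarrow> bool" where
  "is_system_iso \<Gamma> \<Lambda> X \<theta> \<Xi> Y \<psi> h0 h \<longleftrightarrow>
     (\<forall>v\<in>verts \<Gamma>. is_kgraph_iso (\<Lambda> v) (\<Xi> v) (h0 v)) \<and>
     (\<forall>g\<in>paths \<Gamma>.
        bij_betw (h g) (elts (X g)) (elts (Y g)) \<and>
        (\<forall>x\<in>elts (X g).
           msrc (Y g) (h g x) = h0 (src \<Gamma> g) (msrc (X g) x) \<and>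
           mrng (Y g) (h g x) = h0 (rng \<Gamma> g) (mrng (X g) x)) \<and>
        (\<forall>p\<in>phi_dom (\<Lambda> (src \<Gamma> g)) (X g).
           map_prod (h0 (rng \<Gamma> g)) (h g) (phi (X g) p) =
           phi (Y g) (map_prod (h g) (h0 (src \<Gamma> g)) p))) \<and>
     (\<forall>a\<in>paths \<Gamma>. \<forall>b\<in>paths \<Gamma>. src \<Gamma> a = rng \<Gamma> b \<longrightarrow>
        (\<forall>p\<in>fprod (elts (X a)) (msrc (X a)) (elts (X b)) (mrng (X b)).
           h (cmp \<Gamma> a b) (\<theta> a b p) = \<psi> a b (map_prod (h a) (h b) p)))"


section \<open>Composition in \<open>Mcat k\<close> satisfies \<open>[X\<^sub>1][X\<^sub>2] = [X\<^sub>1 * X\<^sub>2]\<close>\<close>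

lemma kgraphD:
  assumes "is_kgraph k L"
  shows "\<And>f. f \<in> paths L \<Longrightarrow> src L f \<in> verts L \<and> rng L f \<in> verts L"
    "\<And>v. v \<in> verts L \<Longrightarrow> v \<in> paths L \<and> src L v = v \<and> rng L v = v"
    "\<And>f g. \<lbrakk>f \<in> paths L; g \<in> paths L; src L f = rng L g\<rbrakk> \<Longrightarrow>
       cmp L f g \<in> paths L \<and> src L (cmp L f g) = src L g \<and> rng L (cmp L f g) = rng L f"
    "\<And>f. f \<in> paths L \<Longrightarrow> cmp L (rng L f) f = f \<and> cmp L f (src L f) = f"
    "\<And>f g h. \<lbrakk>f \<in> paths L; g \<in> paths L; h \<in> paths L; src L f = rng L g; src L g = rng L h\<rbrakk> \<Longrightarrow>
       cmp L (cmp L f g) h = cmp L f (cmp L g h)"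
  using assms unfolding is_kgraph_def category_def kcat_def by auto

lemma is_morph_id:
  assumes L: "is_kgraph k L" shows "is_morph L L (id_morph L)"
  unfolding is_morph_def
proof (intro conjI)
  have sub: "verts L \<subseteq> paths L" by (auto simp: verts_def)
  show "countable (elts (id_morph L))"
    using L sub countable_subset by (auto simp: id_morph_def is_kgraph_def)
  show "bij_betw (phi (id_morph L)) (phi_dom L (id_morph L)) (phi_cod L (id_morph L))"
    by (rule bij_betw_byWitness[where f' = "\<lambda>(l, v). (rng L l, l)"])
      (use kgraphD[OF L] in \<open>auto simp: id_morph_def fprod_def\<close>)
qed (use kgraphD[OF L] in \<open>auto simp: id_morph_def fprod_def split: if_splits\<close>)

lemma morphD:
  assumes "is_morph L G X"
  shows "\<And>x. x \<in> elts X \<Longrightarrow> mrng X x \<in> verts L \<and> msrc X x \<in> verts G"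
   "\<And>x g l y. \<lbrakk>x \<in> elts X; g \<in> paths G; msrc X x = rng G g; phi X (x,g) = (l,y)\<rbrakk> \<Longrightarrow>
      l \<in> paths L \<and> y \<in> elts X \<and> src L l = mrng X y \<and> deg G g = deg L l \<and> src G g = msrc X y
      \<and> rng L l = mrng X x"
   "\<And>x g l y g2 l2 y2. \<lbrakk>x \<in> elts X; g \<in> paths G; msrc X x = rng G g; phi X (x,g) = (l,y);
      g2 \<in> paths G; msrc X y = rng G g2; phi X (y,g2) = (l2,y2)\<rbrakk> \<Longrightarrow>
      phi X (x, cmp G g g2) = (cmp L l l2, y2)"
proof goal_cases
  case (1 x) then show ?case using assms by (auto simp: is_morph_def)
next
  case A: (2 x g l y)
  then have "phi X (x,g) \<in> phi_cod L X"
    using assms bij_betwE unfolding is_morph_def by (fastforce simp: fprod_def)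
  moreover have "deg G g = deg L l \<and> src G g = msrc X y \<and> rng L l = mrng X x"
    using assms A unfolding is_morph_def fprod_def by blast
  ultimately show ?case using A by (auto simp: fprod_def)
next
  case A: (3 x g l y g2 l2 y2)
  have "(x,g) \<in> phi_dom G X \<and> phi X (x,g) = (l,y)" using A by (auto simp: fprod_def)
  then have "y \<in> elts X" using assms A unfolding is_morph_def
    by (metis (mono_tags, lifting) bij_betwE fprod_def case_prod_conv mem_Collect_eq)
  with A assms show ?case unfolding is_morph_def fprod_def by blast
qed

lemma comp_simps:
  "elts (comp_morph L2 X1 X2) = fprod (elts X1) (msrc X1) (elts X2) (mrng X2)"
  "\<And>x y. x \<in> elts X1 \<Longrightarrow> y \<in> elts X2 \<Longrightarrow> msrc X1 x = mrng X2 y \<Longrightarrow> mrng (comp_morph L2 X1 X2) (x,y) = mrng X1 x"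
  "\<And>x y. x \<in> elts X1 \<Longrightarrow> y \<in> elts X2 \<Longrightarrow> msrc X1 x = mrng X2 y \<Longrightarrow> msrc (comp_morph L2 X1 X2) (x,y) = msrc X2 y"
  "\<And>x y g. x \<in> elts X1 \<Longrightarrow> y \<in> elts X2 \<Longrightarrow> msrc X1 x = mrng X2 y \<Longrightarrow> g \<in> paths L2 \<Longrightarrow> msrc X2 y = rng L2 g \<Longrightarrow>
    phi (comp_morph L2 X1 X2) ((x,y),g) =
     (let (l1, x2') = phi X2 (y, g); (l0, x1') = phi X1 (x, l1) in (l0, (x1', x2')))"
  by (auto simp: comp_morph_def Let_def fprod_def)

lemma is_morph_comp:
  assumes L2: "is_kgraph k L2" and A: "is_morph L0 L1 X" and B: "is_morph L1 L2 Y"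
  shows "is_morph L0 L2 (comp_morph L2 X Y)"
proof -
  let ?Z = "comp_morph L2 X Y"
  have bX: "bij_betw (phi X) (phi_dom L1 X) (phi_cod L0 X)"
   and bY: "bij_betw (phi Y) (phi_dom L2 Y) (phi_cod L1 Y)" using A B by (auto simp: is_morph_def)
  define f where "f = (\<lambda>((x1, x2), l2).
                  let (l1, x2') = phi Y (x2, l2); (l0, x1') = phi X (x1, l1)
                  in (l0, (x1', x2')))"
  define ix where "ix = inv_into (phi_dom L1 X) (phi X)"
  define iy where "iy = inv_into (phi_dom L2 Y) (phi Y)"
  define g where "g = (\<lambda>(l0, (x1, x2)).
                  let (x1',l1) = ix (l0,x1); (x2', l2) = iy (l1, x2)
                  in ((x1',x2'),l2))"
  have dom: "phi_dom L2 ?Z = {((x,y),g). x \<in> elts X \<and> y \<in> elts Y \<and> msrc X x = mrng Y y \<and> g \<in> paths L2 \<and> msrc Y y = rng L2 g}"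
    by (auto simp: comp_simps fprod_def)
  have cod: "phi_cod L0 ?Z = {(l,(x,y)). x \<in> elts X \<and> y \<in> elts Y \<and> msrc X x = mrng Y y \<and> l \<in> paths L0 \<and> src L0 l = mrng X x}"
    by (auto simp: comp_simps fprod_def)
  have eq: "\<And>p. p \<in> phi_dom L2 ?Z \<Longrightarrow> phi ?Z p = f p"
    unfolding dom f_def by (auto simp: comp_simps)
  have ixL: "ix (phi X p) = p" if "p \<in> phi_dom L1 X" for p
    using that bX by (simp add: ix_def bij_betw_inv_into_left)
  have ixR: "phi X (ix p) = p" "ix p \<in> phi_dom L1 X" if "p \<in> phi_cod L0 X" for p
    using that bX  by (auto simp add: ix_def bij_betw_inv_into_right) (metis bij_betw_def inv_into_into)
  have iyL: "iy (phi Y p) = p" if "p \<in> phi_dom L2 Y" for p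
    using that bY by (simp add: iy_def bij_betw_inv_into_left)
  have iyR: "phi Y (iy p) = p" "iy p \<in> phi_dom L2 Y" if "p \<in> phi_cod L1 Y" for p
    using that bY  by (auto simp add: iy_def bij_betw_inv_into_right) (metis bij_betw_def inv_into_into)
  have 1: "f p \<in> phi_cod L0 ?Z \<and> g (f p) = p" if p: "p \<in> phi_dom L2 ?Z" for p
  proof -
    obtain x y h where [simp]: "p = ((x,y),h)" by (metis surj_pair)
    obtain l1 y' where y: "phi Y (y,h) = (l1,y')" by (metis surj_pair)
    obtain l0 x' where x: "phi X (x,l1) = (l0,x')" by (metis surj_pair)
    have p': "x \<in> elts X" "y \<in> elts Y" "msrc X x = mrng Y y" "h \<in> paths L2" "msrc Y y = rng L2 h"
      using p unfolding dom by auto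
    note Y = morphD(2)[OF B p'(2) p'(4) p'(5) y]
    have sx: "msrc X x = rng L1 l1" using Y p' by simp
    note X = morphD(2)[OF A p'(1) _ sx x]
    have "iy (l1,y') = (y,h)" using iyL[of "(y,h)"] y p' by (auto simp: fprod_def)
    moreover have "ix (l0,x') = (x,l1)" using ixL[of "(x,l1)"] x p' Y sx by (auto simp: fprod_def)
    ultimately show ?thesis unfolding cod using X Y x y by (auto simp: f_def g_def)
  qed
  have 2: "g q \<in> phi_dom L2 ?Z \<and> f (g q) = q" if q: "q \<in> phi_cod L0 ?Z" for q
  proof -
    obtain l x' y' where [simp]: "q = (l,(x',y'))" by (metis surj_pair)
    have q': "x' \<in> elts X" "y' \<in> elts Y" "msrc X x' = mrng Y y'" "l \<in> paths L0" "src L0 l = mrng X x'"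
      using q unfolding cod by auto
    obtain x l1 where x: "ix (l,x') = (x,l1)" by (metis surj_pair)
    have px: "phi X (x,l1) = (l,x')" "x \<in> elts X" "l1 \<in> paths L1" "msrc X x = rng L1 l1"
      using ixR[of "(l,x')"] x q' by (auto simp: fprod_def)
    note X = morphD(2)[OF A px(2,3,4,1)]
    obtain y h where y: "iy (l1,y') = (y,h)" by (metis surj_pair)
    have py: "phi Y (y,h) = (l1,y')" "y \<in> elts Y" "h \<in> paths L2" "msrc Y y = rng L2 h"
      using iyR[of "(l1,y')"] y q' px X by (auto simp: fprod_def)
    note Y = morphD(2)[OF B py(2,3,4,1)]
    show ?thesis unfolding dom using px py X Y x y by (auto simp: f_def g_def)
  qed
  have "bij_betw f (phi_dom L2 ?Z) (phi_cod L0 ?Z)"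
    by (rule bij_betw_byWitness[where f' = g]) (use 1 2 in auto)
  then have bij: "bij_betw (phi ?Z) (phi_dom L2 ?Z) (phi_cod L0 ?Z)"
    using eq bij_betw_cong by blast
  show ?thesis
    unfolding is_morph_def
  proof (intro conjI allI impI bij, goal_cases)
    case 1 
    have "elts ?Z \<subseteq> elts X \<times> elts Y" by (auto simp: comp_simps fprod_def)
    moreover have "countable (elts X \<times> elts Y)" using A B by (auto simp: is_morph_def)
    ultimately show ?case by (rule countable_subset)
  next
    case 2 show ?case using A by (auto simp: comp_morph_def Let_def is_morph_def fprod_def)
  next
    case 3 show ?case using B by (auto simp: comp_morph_def Let_def is_morph_def fprod_def)
  next
    case 4 show ?case by (auto simp: comp_morph_def Let_def)
  next
    case (5 p h l0 q)
    obtain x y x' y' where [simp]: "p = (x,y)" "q = (x',y')" by (metis surj_pair)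
    obtain l1 yy where y: "phi Y (y,h) = (l1,yy)" by (metis surj_pair)
    have p': "x \<in> elts X" "y \<in> elts Y" "msrc X x = mrng Y y" "h \<in> paths L2" "msrc Y y = rng L2 h"
      using 5 unfolding dom by auto
    have x: "phi X (x,l1) = (l0,x')" and [simp]: "yy = y'"
      using 5 y p' by (auto simp: comp_simps split: prod.splits)
    note Y = morphD(2)[OF B p'(2) p'(4) p'(5) y]
    have "msrc X x = rng L1 l1" using Y p' by simp
    note X = morphD(2)[OF A p'(1) _ this x]
    show ?case using X Y p' by (auto simp: comp_simps)
  next
    case (6 p h l0 q) then show ?case  
    proof -
      obtain x y x' y' where [simp]: "p = (x,y)" "q = (x',y')" by (metis surj_pair)
      obtain l1 yy where y: "phi Y (y,h) = (l1,yy)" by (metis surj_pair)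
      have p': "x \<in> elts X" "y \<in> elts Y" "msrc X x = mrng Y y" "h \<in> paths L2" "msrc Y y = rng L2 h"
        using 6 unfolding dom by auto
      have x: "phi X (x,l1) = (l0,x')" and [simp]: "yy = y'"
        using 6 y p' by (auto simp: comp_simps split: prod.splits)
      note Y = morphD(2)[OF B p'(2) p'(4) p'(5) y]
      have "msrc X x = rng L1 l1" using Y p' by simp
      note X = morphD(2)[OF A p'(1) _ this x]
      show ?case using X Y p' by (auto simp: comp_simps)
    qed
  next
    case (7 p h l0 q)
    obtain x y x' y' where [simp]: "p = (x,y)" "q = (x',y')" by (metis surj_pair)
    obtain l1 yy where y: "phi Y (y,h) = (l1,yy)" by (metis surj_pair)
    have p': "x \<in> elts X" "y \<in> elts Y" "msrc X x = mrng Y y" "h \<in> paths L2" "msrc Y y = rng L2 h"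
      using 7 unfolding dom by auto
    have x: "phi X (x,l1) = (l0,x')" and [simp]: "yy = y'"
      using 7 y p' by (auto simp: comp_simps split: prod.splits)
    note Y = morphD(2)[OF B p'(2) p'(4) p'(5) y]
    have "msrc X x = rng L1 l1" using Y p' by simp
    note X = morphD(2)[OF A p'(1) _ this x]
    show ?case using X Y p' by (auto simp: comp_simps)
  next
    case (8 p h l0 q h2 l2 q2)
    obtain x y x' y' where [simp]: "p = (x,y)" "q = (x',y')" by (metis surj_pair)
    obtain x2 y2 where [simp]: "q2 = (x2,y2)" by (metis surj_pair)
    obtain l1 yy where y: "phi Y (y,h) = (l1,yy)" by (metis surj_pair)
    have p': "x \<in> elts X" "y \<in> elts Y" "msrc X x = mrng Y y" "h \<in> paths L2" "msrc Y y = rng L2 h"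
      using 8 unfolding dom by auto
    have x: "phi X (x,l1) = (l0,x')" and [simp]: "yy = y'"
      using 8 y p' by (auto simp: comp_simps split: prod.splits)
    note Y = morphD(2)[OF B p'(2) p'(4) p'(5) y]
    have sx: "msrc X x = rng L1 l1" using Y p' by simp
    note X = morphD(2)[OF A p'(1) _ sx x]
    obtain m1 zz where y2: "phi Y (y',h2) = (m1,zz)" by (metis surj_pair)
    have q': "x' \<in> elts X" "y' \<in> elts Y" "msrc X x' = mrng Y y'" "h2 \<in> paths L2" "msrc Y y' = rng L2 h2"
      using 8 unfolding dom by auto
    have x2: "phi X (x',m1) = (l2,x2)" and [simp]: "zz = y2"
      using 8 y2 q' by (auto simp: comp_simps split: prod.splits)
    note Y2 = morphD(2)[OF B q'(2) q'(4) q'(5) y2]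
    have sx': "msrc X x' = rng L1 m1" using Y2 q' by simp
    have a: "phi Y (y, cmp L2 h h2) = (cmp L1 l1 m1, y2)"
      using morphD(3)[OF B, of y h l1 y' h2 m1 y2] y y2 p' q' by simp
    have b: "phi X (x, cmp L1 l1 m1) = (cmp L0 l0 l2, x2)"
      using morphD(3)[OF A, of x l1 l0 x' m1 l2 x2] x x2 sx sx' p' Y Y2 by simp
    have "((x,y), cmp L2 h h2) \<in> phi_dom L2 ?Z \<longrightarrow> ?case"
      using eq a b by (auto simp: f_def)
    moreover have "cmp L2 h h2 \<in> paths L2 \<and> rng L2 (cmp L2 h h2) = rng L2 h"
      using kgraphD(3)[OF L2] q' p' Y by simp
    ultimately show ?case using p' unfolding dom by auto
  qed
qed

lemma iso_refl: "is_morph L G X \<Longrightarrow> is_morph_iso L G X X id"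
  by (auto simp: is_morph_iso_def map_prod.id)

lemma iso_trans:
  assumes "is_morph_iso L G X Y f" "is_morph_iso L G Y Z g" shows "is_morph_iso L G X Z (g \<circ> f)"
proof -
  have f: "\<And>x. x \<in> elts X \<Longrightarrow> f x \<in> elts Y" using assms(1) bij_betwE by (fastforce simp: is_morph_iso_def)
  have "map_prod id (g \<circ> f) (phi X p) = phi Z (map_prod (g \<circ> f) id p)" if p: "p \<in> phi_dom G X" for p
  proof -
    have q: "map_prod f id p \<in> phi_dom G Y" using p f assms(1) by (auto simp: is_morph_iso_def fprod_def)
    have "map_prod id (g \<circ> f) (phi X p) = map_prod id g (map_prod id f (phi X p))"
      by (simp add: prod.map_comp map_prod_def case_prod_beta)
    also have "\<dots> = map_prod id g (phi Y (map_prod f id p))" using assms(1) p by (simp add: is_morph_iso_def)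
    also have "\<dots> = phi Z (map_prod g id (map_prod f id p))" using assms(2) q by (simp add: is_morph_iso_def)
    finally show ?thesis by (simp add: map_prod_def case_prod_beta)
  qed
  then show ?thesis using assms f bij_betw_trans unfolding is_morph_iso_def by (auto 4 3)
qed

lemma iso_comp:
  assumes L2: "is_kgraph k L2" and X: "is_morph_iso L0 L1 X X' f" and Y: "is_morph_iso L1 L2 Y Y' g"
  shows "is_morph_iso L0 L2 (comp_morph L2 X Y) (comp_morph L2 X' Y') (map_prod f g)"
proof -
  have fx: "\<And>x. x \<in> elts X \<Longrightarrow> f x \<in> elts X' \<and> mrng X' (f x) = mrng X x \<and> msrc X' (f x) = msrc X x" 
    using X bij_betwE by (fastforce simp: is_morph_iso_def)
  have gy: "\<And>x. x \<in> elts Y \<Longrightarrow> g x \<in> elts Y' \<and> mrng Y' (g x) = mrng Y x \<and> msrc Y' (g x) = msrc Y x" 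
    using Y bij_betwE by (fastforce simp: is_morph_iso_def)
  have mX: "is_morph L0 L1 X" "is_morph L0 L1 X'" and mY: "is_morph L1 L2 Y" "is_morph L1 L2 Y'"
    using X Y by (auto simp: is_morph_iso_def)
  have bf: "bij_betw f (elts X) (elts X')" and bg: "bij_betw g (elts Y) (elts Y')"
    using X Y by (auto simp: is_morph_iso_def)
  have "bij_betw (map_prod f g) (elts (comp_morph L2 X Y)) (elts (comp_morph L2 X' Y'))"
    unfolding bij_betw_def
  proof
    show "inj_on (map_prod f g) (elts (comp_morph L2 X Y))"
      using bf bg by (auto simp: inj_on_def bij_betw_def comp_simps fprod_def)
    show "map_prod f g ` elts (comp_morph L2 X Y) = elts (comp_morph L2 X' Y')"
    proof (intro equalityI subsetI)
      fix p assume "p \<in> elts (comp_morph L2 X' Y')"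
      then obtain x' y' where p: "p = (x', y')" "x' \<in> elts X'" "y' \<in> elts Y'" "msrc X' x' = mrng Y' y'"
        by (auto simp: comp_simps fprod_def)
      obtain x y where "x \<in> elts X" "x' = f x" "y \<in> elts Y" "y' = g y"
        using bf bg p(2,3) unfolding bij_betw_def by blast
      with p have "p = (f x, g y)" "x \<in> elts X" "y \<in> elts Y" "msrc X' (f x) = mrng Y' (g y)"
        by simp_all
      then show "p \<in> map_prod f g ` elts (comp_morph L2 X Y)"
        using fx gy by (auto simp: comp_simps fprod_def intro!: rev_image_eqI[of "(x,y)"])
    qed (use fx gy in \<open>auto simp: comp_simps fprod_def\<close>)
  qed
  moreover have "map_prod id (map_prod f g) (phi (comp_morph L2 X Y) ((x,y),h)) =
       phi (comp_morph L2 X' Y') ((f x,g y),h)"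
    if p': "x \<in> elts X" "y \<in> elts Y" "msrc X x = mrng Y y" "h \<in> paths L2" "msrc Y y = rng L2 h" for x y h
  proof -
    obtain l1 y' where y: "phi Y (y,h) = (l1,y')" by (metis surj_pair)
    obtain l0 x' where x: "phi X (x,l1) = (l0,x')" by (metis surj_pair)
    note YY = morphD(2)[OF mY(1) p'(2) p'(4) p'(5) y]
    have sx: "msrc X x = rng L1 l1" using YY p' by simp
    have "(y,h) \<in> phi_dom L2 Y" using p' by (auto simp: fprod_def)
    then have 1: "phi Y' (g y,h) = (l1, g y')" using Y y unfolding is_morph_iso_def by fastforce
    have "(x,l1) \<in> phi_dom L1 X" using p' YY sx by (auto simp: fprod_def)
    then have 2: "phi X' (f x,l1) = (l0, f x')" using X x unfolding is_morph_iso_def by fastforce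
    show ?thesis using p' fx gy x y 1 2 by (simp add: comp_simps)
  qed
  ultimately show ?thesis unfolding is_morph_iso_def
    using is_morph_comp[OF L2 mX(1) mY(1)] is_morph_comp[OF L2 mX(2) mY(2)] fx gy
    by (auto simp: comp_simps fprod_def)
qed

lemma mcomp_mclass:
  fixes X Y :: "('u, 'u, 'u) morph"
  assumes "is_kgraph k L2" "is_morph L0 L1 X" "is_morph L1 L2 Y"
  shows "mcomp (mclass L0 L1 X) (mclass L1 L2 Y) = mclass L0 L2 (comp_morph L2 X Y)"
proof -
  have "morph_isomorphic L0 L2 (comp_morph L2 X Y) Z"
    if "morph_isomorphic L0 L1 X X'" "morph_isomorphic L1 L2 Y Y'"
       "morph_isomorphic L0 L2 (comp_morph L2 X' Y') Z" for X' Y' and Z :: "('u,'u,'u) morph"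
    using that iso_comp[OF assms(1)] iso_trans unfolding morph_isomorphic_def by blast
  moreover have "morph_isomorphic L0 L1 X X" "morph_isomorphic L1 L2 Y Y"
    using assms iso_refl unfolding morph_isomorphic_def by blast+
  ultimately show ?thesis unfolding mcomp_def mclass_def by auto
qed

end

theory Submission
  imports Defs
begin

text \<open>
  A 1-graph is the free category on its edges: a path that is not a vertex is uniquely \<open>ea\<close> with
  \<open>e\<close> an edge, so maps indexed by paths may be chosen freely on edges and extended by recursion.
  For existence, choose \<open>X\<^sub>\<gamma>\<close> in each class \<open>F(\<gamma>)\<close>, with \<open>X\<^sub>v = I\<close>, and an isomorphism
  \<open>\<tau>\<^bsub>e,a\<^esub> : X\<^sub>e * X\<^sub>a \<rightarrow> X\<^bsub>ea\<^esub>\<close> for each edge \<open>e\<close>, the canonical one if \<open>a\<close> is a vertex.  The equation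
  \<open>\<theta>\<^bsub>ea,b\<^esub>(\<tau>\<^bsub>e,a\<^esub>(x, x'), y) = \<tau>\<^bsub>e,ab\<^esub>(x, \<theta>\<^bsub>a,b\<^esub>(x', y))\<close>, the case of associativity with an edge on the
  left, then determines \<open>\<theta>\<close>, and the full associativity law follows by induction on the first path.
  For uniqueness, isomorphisms \<open>j\<^sub>e : X\<^sub>e \<rightarrow> Y\<^sub>e\<close> chosen on edges extend to all paths by
  \<open>h\<^bsub>ea\<^esub> \<circ> \<theta>\<^bsub>e,a\<^esub> = \<psi>\<^bsub>e,a\<^esub> \<circ> (j\<^sub>e \<times> h\<^sub>a)\<close>, starting from the identity on vertices.
\<close>

section \<open>Paths in a 1-graph\<close>

text \<open>Intended for 1-graphs, where coordinate 0 carries the whole degree.\<close>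

definition edges :: "'a kgraph \<Rightarrow> 'a set" where
  "edges G = {e \<in> paths G. deg G e 0 = 1}"

lemma kgraph_deg_cmp:
  assumes "is_kgraph k L" "f \<in> paths L" "g \<in> paths L" "src L f = rng L g"
  shows "deg L (cmp L f g) = deg L f + deg L g"
  using assms unfolding is_kgraph_def fprod_def by blast

locale one_graph =
  fixes G :: "'g kgraph"
  assumes G: "is_kgraph 1 G"
begin

text \<open>An element of \<open>NN 1\<close> is determined by its value at 0, so degrees can be
  handled as natural numbers.\<close>

lemma deg_eq_iff:
  assumes "f \<in> paths G" "n \<in> NN 1"
  shows "deg G f = n \<longleftrightarrow> deg G f 0 = n 0"
proof -
  have "deg G \<in> paths G \<rightarrow>\<^sub>E NN 1" using G unfolding is_kgraph_def by blast
  then have "deg G f \<in> NN 1" using assms(1) by (rule PiE_mem)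
  then have "deg G f i = n i" if "i \<noteq> 0" for i
    using assms(2) that by (simp add: NN_def)
  then show ?thesis by (metis ext)
qed

lemma verts_iff: "v \<in> verts G \<longleftrightarrow> v \<in> paths G \<and> deg G v 0 = 0"
  using deg_eq_iff[of v 0] by (auto simp: verts_def NN_def)

lemma edgesD: "e \<in> edges G \<Longrightarrow> e \<in> paths G"
  by (simp add: edges_def)

lemma unique_factorisation:
  assumes "l \<in> paths G" "deg G l 0 = m + n"
  shows "\<exists>!p. fst p \<in> paths G \<and> snd p \<in> paths G \<and> src G (fst p) = rng G (snd p) \<and>
    deg G (fst p) 0 = m \<and> deg G (snd p) 0 = n \<and> l = cmp G (fst p) (snd p)"
proof -
  \<comment> \<open>\<open>c\<close> embeds the natural numbers in \<open>NN 1\<close>.\<close>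
  define c where "c = (\<lambda>n i. if i = (0::nat) then n else (0::nat))"
  have c: "c j \<in> NN 1" for j by (auto simp: c_def NN_def)
  have "c m + c n \<in> NN 1" by (auto simp: c_def NN_def)
  then have "deg G l = c m + c n"
    using assms by (simp add: deg_eq_iff) (simp add: c_def)
  then have "\<exists>!p. p \<in> fprod (paths G) (src G) (paths G) (rng G) \<and>
      deg G (fst p) = c m \<and> deg G (snd p) = c n \<and> l = cmp G (fst p) (snd p)"
    using G assms(1) c unfolding is_kgraph_def by blast
  moreover have "f \<in> paths G \<Longrightarrow> deg G f = c j \<longleftrightarrow> deg G f 0 = j" for f j
    using deg_eq_iff c by (simp add: c_def)
  then have "(p \<in> fprod (paths G) (src G) (paths G) (rng G) \<and>
      deg G (fst p) = c m \<and> deg G (snd p) = c n \<and> l = cmp G (fst p) (snd p)) \<longleftrightarrow>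
     (fst p \<in> paths G \<and> snd p \<in> paths G \<and> src G (fst p) = rng G (snd p) \<and>
    deg G (fst p) 0 = m \<and> deg G (snd p) 0 = n \<and> l = cmp G (fst p) (snd p))" for p
    by (auto simp: fprod_def case_prod_beta)
  ultimately show ?thesis by simp
qed

lemma edge_factor:
  assumes "g \<in> paths G" "deg G g 0 = Suc n"
  obtains e a where "e \<in> edges G" "a \<in> paths G" "src G e = rng G a" "g = cmp G e a"
    "deg G a 0 = n"
proof -
  have "deg G g 0 = 1 + n" using assms by simp
  from unique_factorisation[OF assms(1) this, THEN ex1_implies_ex] show ?thesis
    using that unfolding edges_def by blast
qed

lemma deg_cmp_edge:
  assumes "e \<in> edges G" "a \<in> paths G" "src G e = rng G a"
  shows "deg G (cmp G e a) 0 = Suc (deg G a 0)"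
  using kgraph_deg_cmp[OF G, of e a] assms by (simp add: edges_def)

text \<open>Additivity of degrees gives \<open>a\<close> and \<open>a'\<close> the same length, so
  both pairs factor one path with the same degrees and must coincide.\<close>

lemma edge_factor_unique:
  assumes "e \<in> edges G" "a \<in> paths G" "src G e = rng G a"
    and "e' \<in> edges G" "a' \<in> paths G" "src G e' = rng G a'"
    and eq: "cmp G e a = cmp G e' a'"
  shows "e = e'" "a = a'"
proof -
  let ?l = "cmp G e a"
  have l: "?l \<in> paths G" "deg G ?l 0 = 1 + deg G a 0"
    using kgraphD(3)[OF G] deg_cmp_edge assms(1-3) by (simp_all add: edges_def)
  have "deg G a' 0 = deg G a 0"
    using deg_cmp_edge[OF assms(1-3)] deg_cmp_edge[OF assms(4-6)] eq by simp
  moreover obtain p where p: "\<And>q. fst q \<in> paths G \<and> snd q \<in> paths G \<and>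
      src G (fst q) = rng G (snd q) \<and> deg G (fst q) 0 = 1 \<and> deg G (snd q) 0 = deg G a 0 \<and>
      ?l = cmp G (fst q) (snd q) \<Longrightarrow> q = p"
    using unique_factorisation[OF l] unfolding Ex1_def by iprover
  ultimately have "(e, a) = p" "(e', a') = p"
    using p[of "(e, a)"] p[of "(e', a')"] assms by (simp_all add: edges_def)
  then show "e = e'" "a = a'" by auto
qed

text \<open>Induction on length, splitting off the edge at the range end, which is the left
  factor.\<close>

lemma path_induct [consumes 1, case_names vert cmp]:
  assumes "g \<in> paths G"
    and vert: "\<And>v. v \<in> verts G \<Longrightarrow> P v"
    and cmp: "\<And>e a. \<lbrakk>e \<in> edges G; a \<in> paths G; src G e = rng G a; P a\<rbrakk> \<Longrightarrow> P (cmp G e a)"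
  shows "P g"
  using assms(1)
proof (induction "deg G g 0" arbitrary: g)
  case 0
  then show ?case using vert verts_iff by simp
next
  case (Suc n)
  from Suc.prems Suc.hyps(2)[symmetric] obtain e a where "e \<in> edges G" "a \<in> paths G"
    "src G e = rng G a" "g = cmp G e a" "deg G a 0 = n"
    by (rule edge_factor)
  then show ?case using cmp Suc.hyps(1) by blast
qed

text \<open>Freeness of the path category: the first edge of a nonvertex path is unique, so values
  on vertices and a rule for prepending an edge can be prescribed at will.\<close>

lemma path_recursion:
  obtains H :: "'g \<Rightarrow> 'b"
  where "\<And>v. v \<in> verts G \<Longrightarrow> H v = B v"
    and "\<And>e a. \<lbrakk>e \<in> edges G; a \<in> paths G; src G e = rng G a\<rbrakk> \<Longrightarrow> H (cmp G e a) = S e a (H a)"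
proof -
  \<comment> \<open>\<open>c\<close> chooses a first edge and a remainder; uniqueness turns the
    choice into an evaluation rule on \<open>cmp G e a\<close>.\<close>
  define c where "c g = (SOME p. fst p \<in> edges G \<and> snd p \<in> paths G \<and>
    src G (fst p) = rng G (snd p) \<and> g = cmp G (fst p) (snd p))" for g
  have c: "c (cmp G e a) = (e, a)" if "e \<in> edges G" "a \<in> paths G" "src G e = rng G a" for e a
    unfolding c_def
  proof (rule some_equality)
    show "p = (e, a)" if "fst p \<in> edges G \<and> snd p \<in> paths G \<and>
      src G (fst p) = rng G (snd p) \<and> cmp G e a = cmp G (fst p) (snd p)" for p
      using edge_factor_unique[of "fst p" "snd p" e a] that
        \<open>e \<in> edges G\<close> \<open>a \<in> paths G\<close> \<open>src G e = rng G a\<close> by (simp add: prod_eq_iff)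
  qed (use that in simp)
  \<comment> \<open>Stage \<open>Suc n\<close> applies stage \<open>n\<close> to the remainder
    \<open>snd (c g)\<close>, which is one shorter; a path is evaluated at the stage given by its
    own length.\<close>
  define K where "K = rec_nat B (\<lambda>n f g. S (fst (c g)) (snd (c g)) (f (snd (c g))))"
  show ?thesis
  proof (rule that[of "\<lambda>g. K (deg G g 0) g"])
    show "K (deg G v 0) v = B v" if "v \<in> verts G" for v
      using that by (simp add: verts_iff K_def)
    show "K (deg G (cmp G e a) 0) (cmp G e a) = S e a (K (deg G a 0) a)"
      if "e \<in> edges G" "a \<in> paths G" "src G e = rng G a" for e a
      using that by (simp add: deg_cmp_edge c K_def)
  qed
qed

end


section \<open>Isomorphisms of morphs\<close>

lemma is_morph_isoI:
  assumes "is_morph L G X" "is_morph L G Y" "bij_betw \<theta> (elts X) (elts Y)"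
    and "\<And>x. x \<in> elts X \<Longrightarrow> mrng Y (\<theta> x) = mrng X x"
    and "\<And>x. x \<in> elts X \<Longrightarrow> msrc Y (\<theta> x) = msrc X x"
    and "\<And>x g l y. \<lbrakk>x \<in> elts X; g \<in> paths G; msrc X x = rng G g; phi X (x, g) = (l, y)\<rbrakk> \<Longrightarrow>
      phi Y (\<theta> x, g) = (l, \<theta> y)"
  shows "is_morph_iso L G X Y \<theta>"
  unfolding is_morph_iso_def
proof (intro conjI ballI)
  fix p assume "p \<in> phi_dom G X"
  then show "map_prod id \<theta> (phi X p) = phi Y (map_prod \<theta> id p)"
    using assms(6) by (cases p, cases "phi X p") (auto simp: fprod_def)
qed (use assms in auto)

lemma is_morph_isoD:
  assumes "is_morph_iso L G X Y \<theta>"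
  shows "is_morph L G X" "is_morph L G Y" "bij_betw \<theta> (elts X) (elts Y)"
    and "\<And>x. x \<in> elts X \<Longrightarrow> \<theta> x \<in> elts Y"
    and "\<And>x. x \<in> elts X \<Longrightarrow> mrng Y (\<theta> x) = mrng X x"
    and "\<And>x. x \<in> elts X \<Longrightarrow> msrc Y (\<theta> x) = msrc X x"
    and "\<And>x g l y. \<lbrakk>x \<in> elts X; g \<in> paths G; msrc X x = rng G g; phi X (x, g) = (l, y)\<rbrakk> \<Longrightarrow>
      phi Y (\<theta> x, g) = (l, \<theta> y)"
proof -
  show bij: "bij_betw \<theta> (elts X) (elts Y)" using assms by (simp add: is_morph_iso_def)
  show "\<theta> x \<in> elts Y" if "x \<in> elts X" for x using bij that by (rule bij_betw_apply)
  show "phi Y (\<theta> x, g) = (l, \<theta> y)"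
    if "x \<in> elts X" "g \<in> paths G" "msrc X x = rng G g" "phi X (x, g) = (l, y)" for x g l y
  proof -
    have "(x, g) \<in> phi_dom G X" using that by (simp add: fprod_def)
    then show ?thesis using assms that unfolding is_morph_iso_def by fastforce
  qed
qed (use assms in \<open>auto simp: is_morph_iso_def\<close>)

lemma iso_sym:
  assumes "is_morph_iso L G X Y f"
  shows "is_morph_iso L G Y X (inv_into (elts X) f)"
proof -
  note f = is_morph_isoD[OF assms]
  define g where "g = inv_into (elts X) f"
  have gf: "g (f x) = x" if "x \<in> elts X" for x
    using f(3) that by (simp add: g_def bij_betw_inv_into_left)
  have ex: "\<exists>x. x \<in> elts X \<and> y = f x" if "y \<in> elts Y" for y
    using f(3) that by (auto simp: bij_betw_def)
  have "bij_betw g (elts Y) (elts X)" unfolding g_def using f(3) by (rule bij_betw_inv_into)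
  then have "is_morph_iso L G Y X g"
  proof (intro is_morph_isoI f(1,2))
    fix y h l y' assume y: "y \<in> elts Y" "h \<in> paths G" "msrc Y y = rng G h" "phi Y (y, h) = (l, y')"
    obtain x where x: "x \<in> elts X" "y = f x" using ex y by blast
    \<comment> \<open>By intertwining, \<open>f\<close> carries this value at the preimage to
      \<open>(l, y')\<close>, which forces \<open>m = l\<close> and
      \<open>y' = f x'\<close>.\<close>
    obtain m x' where p: "phi X (x, h) = (m, x')" by (metis surj_pair)
    have s: "msrc X x = rng G h" using x y f(6) by simp
    show "phi X (g y, h) = (l, g y')"
      using f(7)[OF x(1) y(2) s p] morphD(2)[OF f(1) x(1) y(2) s p] x y p gf by auto
  qed (use ex f gf in fastforce)+
  then show ?thesis by (simp add: g_def)
qed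

section \<open>Composites of morphs: units and associativity\<close>

lemma comp_elts_iff:
  "(x, y) \<in> elts (comp_morph L X Y) \<longleftrightarrow> x \<in> elts X \<and> y \<in> elts Y \<and> msrc X x = mrng Y y"
  by (simp add: comp_simps fprod_def)

lemma comp_phi:
  assumes "x \<in> elts X" "y \<in> elts Y" "msrc X x = mrng Y y" "g \<in> paths L" "msrc Y y = rng L g"
    and "phi Y (y, g) = (l, y')" "phi X (x, l) = (m, x')"
  shows "phi (comp_morph L X Y) ((x, y), g) = (m, (x', y'))"
  using assms by (simp add: comp_simps)

text \<open>Traces one evaluation of the composite bijection, with its side conditions:
  \<open>g\<close> passes through \<open>Y\<close> and becomes \<open>l\<close>, then
  \<open>l\<close> passes through \<open>X\<close> and becomes \<open>m\<close>.\<close>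

lemma comp_phiE:
  assumes X: "is_morph L0 L1 X" and Y: "is_morph L1 L2 Y"
    and p: "x \<in> elts X" "y \<in> elts Y" "msrc X x = mrng Y y" "g \<in> paths L2" "msrc Y y = rng L2 g"
  obtains l y' m x' where "phi Y (y, g) = (l, y')" "phi X (x, l) = (m, x')"
    "phi (comp_morph L2 X Y) ((x, y), g) = (m, (x', y'))"
    "l \<in> paths L1" "msrc X x = rng L1 l" "x' \<in> elts X" "y' \<in> elts Y" "msrc X x' = mrng Y y'"
    "m \<in> paths L0" "rng L0 m = mrng X x"
proof -
  obtain l y' where y: "phi Y (y, g) = (l, y')" by (metis surj_pair)
  obtain m x' where x: "phi X (x, l) = (m, x')" by (metis surj_pair)
  note Y' = morphD(2)[OF Y p(2,4,5) y]
  have s: "l \<in> paths L1" "msrc X x = rng L1 l" using Y' p by auto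
  note X' = morphD(2)[OF X p(1) s x]
  show ?thesis using that[OF y x comp_phi[OF p y x]] s X' Y' by simp
qed

lemma id_morph_simps:
  "elts (id_morph L) = verts L"
  "v \<in> verts L \<Longrightarrow> mrng (id_morph L) v = v"
  "v \<in> verts L \<Longrightarrow> msrc (id_morph L) v = v"
  "\<lbrakk>v \<in> verts L; l \<in> paths L; v = rng L l\<rbrakk> \<Longrightarrow> phi (id_morph L) (v, l) = (l, src L l)"
  by (simp_all add: id_morph_def fprod_def)

text \<open>The coordinate in \<open>id_morph L\<close> must equal \<open>mrng X x\<close>, so
  forgetting it loses nothing, and the identity morph hands on the path emitted by \<open>X\<close>
  unchanged.\<close>

lemma iso_id_left:
  assumes L: "is_kgraph k L" and G: "is_kgraph k' G" and X: "is_morph L G X"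
  shows "is_morph_iso L G (comp_morph G (id_morph L) X) X snd"
proof (rule is_morph_isoI)
  note I = is_morph_id[OF L]
  show "is_morph L G (comp_morph G (id_morph L) X)" by (rule is_morph_comp[OF G I X])
  show "bij_betw snd (elts (comp_morph G (id_morph L) X)) (elts X)"
    by (rule bij_betw_byWitness[where f' = "\<lambda>x. (mrng X x, x)"])
      (use morphD(1)[OF X] in \<open>auto simp: comp_elts_iff id_morph_simps\<close>)
  fix p assume p: "p \<in> elts (comp_morph G (id_morph L) X)"
  obtain v x where vx [simp]: "p = (v, x)" by (metis surj_pair)
  have v: "v \<in> verts L" "x \<in> elts X" "v = mrng X x"
    using p by (auto simp: comp_elts_iff id_morph_simps)
  show "mrng X (snd p) = mrng (comp_morph G (id_morph L) X) p"
    "msrc X (snd p) = msrc (comp_morph G (id_morph L) X) p"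
    using v by (simp_all add: comp_simps id_morph_simps)
  fix g l q assume g: "g \<in> paths G" "msrc (comp_morph G (id_morph L) X) p = rng G g"
    and q: "phi (comp_morph G (id_morph L) X) (p, g) = (l, q)"
  have s: "msrc X x = rng G g" using g v by (simp add: comp_simps id_morph_simps)
  have v': "v \<in> elts (id_morph L)" "msrc (id_morph L) v = mrng X x"
    using v by (simp_all add: id_morph_simps)
  obtain h x' m w where h: "phi X (x, g) = (h, x')" "phi (id_morph L) (v, h) = (m, w)"
    "phi (comp_morph G (id_morph L) X) ((v, x), g) = (m, (w, x'))"
    "h \<in> paths L" "msrc (id_morph L) v = rng L h"
    by (rule comp_phiE[OF I X v'(1) v(2) v'(2) g(1) s])
  have "m = h" using h(2) id_morph_simps(3,4)[of v L] v(1) h(4,5) by auto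
  then show "phi X (snd p, g) = (l, snd q)" using h(1,3) q by auto
qed (use X in auto)

text \<open>Mirror image of the left unit: the forgotten coordinate is \<open>msrc X x\<close>, and
  \<open>g\<close> passes the identity morph unchanged before it meets \<open>X\<close>.\<close>

lemma iso_id_right:
  assumes G: "is_kgraph k G" and X: "is_morph L G X"
  shows "is_morph_iso L G (comp_morph G X (id_morph G)) X fst"
proof (rule is_morph_isoI)
  note I = is_morph_id[OF G]
  show "is_morph L G (comp_morph G X (id_morph G))" by (rule is_morph_comp[OF G X I])
  show "bij_betw fst (elts (comp_morph G X (id_morph G))) (elts X)"
    by (rule bij_betw_byWitness[where f' = "\<lambda>x. (x, msrc X x)"])
      (use morphD(1)[OF X] in \<open>auto simp: comp_elts_iff id_morph_simps\<close>)
  fix p assume p: "p \<in> elts (comp_morph G X (id_morph G))"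
  obtain x v where xv [simp]: "p = (x, v)" by (metis surj_pair)
  have v: "v \<in> verts G" "x \<in> elts X" "v = msrc X x"
    using p by (auto simp: comp_elts_iff id_morph_simps)
  show "mrng X (fst p) = mrng (comp_morph G X (id_morph G)) p"
    "msrc X (fst p) = msrc (comp_morph G X (id_morph G)) p"
    using v by (simp_all add: comp_simps id_morph_simps)
  fix g l q assume g: "g \<in> paths G" "msrc (comp_morph G X (id_morph G)) p = rng G g"
    and q: "phi (comp_morph G X (id_morph G)) (p, g) = (l, q)"
  have s: "msrc (id_morph G) v = rng G g" using g v by (simp add: comp_simps id_morph_simps)
  have v': "v \<in> elts (id_morph G)" "msrc X x = mrng (id_morph G) v" "v = rng G g"
    using v s by (simp_all add: id_morph_simps)
  obtain h w m x' where h: "phi (id_morph G) (v, g) = (h, w)" "phi X (x, h) = (m, x')"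
    "phi (comp_morph G X (id_morph G)) ((x, v), g) = (m, (x', w))"
    by (rule comp_phiE[OF X I v(2) v'(1,2) g(1) s])
  have "h = g" using h(1) id_morph_simps(4)[OF v(1) g(1) v'(3)] by simp
  then show "phi X (fst p, g) = (l, fst q)" using h(2,3) q by auto
qed (use X in auto)

abbreviation assoc :: "('x \<times> 'y) \<times> 'z \<Rightarrow> 'x \<times> ('y \<times> 'z)" where
  "assoc \<equiv> \<lambda>((x, y), z). (x, (y, z))"

text \<open>Under either bracketing \<open>g\<close> passes through \<open>Z\<close>, then
  \<open>Y\<close>, then \<open>X\<close>, so the two bijections differ only by
  rebracketing.\<close>

lemma iso_assoc:
  assumes L2: "is_kgraph k L2" and L3: "is_kgraph k' L3"
    and X: "is_morph L0 L1 X" and Y: "is_morph L1 L2 Y" and Z: "is_morph L2 L3 Z"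
  shows "is_morph_iso L0 L3 (comp_morph L3 (comp_morph L2 X Y) Z)
    (comp_morph L3 X (comp_morph L3 Y Z)) assoc" (is "is_morph_iso _ _ ?A ?B _")
proof (rule is_morph_isoI)
  note XY = is_morph_comp[OF L2 X Y] and YZ = is_morph_comp[OF L3 Y Z]
  show "is_morph L0 L3 ?A" "is_morph L0 L3 ?B"
    using is_morph_comp[OF L3 XY Z] is_morph_comp[OF L3 X YZ] .
  show "bij_betw assoc (elts ?A) (elts ?B)"
    by (rule bij_betw_byWitness[where f' = "\<lambda>(x, y, z). ((x, y), z)"])
      (auto simp: comp_elts_iff comp_simps(2,3))
  fix p assume p: "p \<in> elts ?A"
  obtain x y z where [simp]: "p = ((x, y), z)" by (metis surj_pair)
  have e: "x \<in> elts X" "y \<in> elts Y" "z \<in> elts Z" "msrc X x = mrng Y y" "msrc Y y = mrng Z z"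
    using p by (auto simp: comp_elts_iff comp_simps(2,3))
  have eXY: "(x, y) \<in> elts (comp_morph L2 X Y)" "msrc (comp_morph L2 X Y) (x, y) = mrng Z z"
    and eYZ: "(y, z) \<in> elts (comp_morph L3 Y Z)" "msrc X x = mrng (comp_morph L3 Y Z) (y, z)"
    using e by (simp_all add: comp_elts_iff comp_simps(2,3))
  show "mrng ?B (assoc p) = mrng ?A p" "msrc ?B (assoc p) = msrc ?A p"
    using e eXY eYZ by (simp_all add: comp_simps(2,3))
  fix g l q assume g: "g \<in> paths L3" "msrc ?A p = rng L3 g" and q: "phi ?A (p, g) = (l, q)"
  have s: "msrc Z z = rng L3 g" "msrc (comp_morph L3 Y Z) (y, z) = rng L3 g"
    using g e eXY by (simp_all add: comp_simps(2,3))
  obtain l2 z' l1 y' where yz: "phi Z (z, g) = (l2, z')" "phi Y (y, l2) = (l1, y')"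
    "phi (comp_morph L3 Y Z) ((y, z), g) = (l1, (y', z'))" "l2 \<in> paths L2" "msrc Y y = rng L2 l2"
    "l1 \<in> paths L1" "rng L1 l1 = mrng Y y"
    by (rule comp_phiE[OF Y Z e(2,3,5) g(1) s(1)])
  obtain l0 x' where x: "phi X (x, l1) = (l0, x')" by (metis surj_pair)
  note 1 = comp_phi[OF e(1,2,4) yz(4,5,2) x]
  note 2 = comp_phi[OF eXY(1) e(3) eXY(2) g(1) s(1) yz(1) 1]
  note 3 = comp_phi[OF e(1) eYZ g(1) s(2) yz(3) x]
  show "phi ?B (assoc p, g) = (l, assoc q)" using 2 3 q by auto
qed


section \<open>Systems over a 1-graph\<close>

text \<open>\<open>Y\<close> lies in its own class by reflexivity, hence in that of
  \<open>X\<close>. The element type of \<open>X\<close> is left free so that \<open>X\<close> may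
  be a composite, whose elements are pairs.\<close>

lemma mclass_eqD:
  fixes Y :: "('u, 'u, 'u) morph"
  assumes "mclass L G X = mclass L G Y" "is_morph L G Y"
  shows "morph_isomorphic L G X Y"
proof -
  have "morph_isomorphic L G Y Y"
    using assms(2) iso_refl unfolding morph_isomorphic_def by blast
  then show ?thesis using assms(1) by (simp add: mclass_def) blast
qed

lemma is_kgraph_iso_id:
  assumes "is_kgraph k L" shows "is_kgraph_iso L L id"
  using kgraphD[OF assms]
  by (simp add: is_kgraph_iso_def is_category_iso_def is_functor_def kcat_def)

lemma systemD:
  assumes "is_system l k G \<Lambda> X \<theta>"
  shows "\<And>v. v \<in> verts G \<Longrightarrow> is_kgraph k (\<Lambda> v)"
    and "\<And>v. v \<in> verts G \<Longrightarrow> X v = id_morph (\<Lambda> v)"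
    and "\<And>g. g \<in> paths G \<Longrightarrow> is_morph (\<Lambda> (rng G g)) (\<Lambda> (src G g)) (X g)"
    and "\<And>a b. \<lbrakk>a \<in> paths G; b \<in> paths G; src G a = rng G b\<rbrakk> \<Longrightarrow>
      is_morph_iso (\<Lambda> (rng G a)) (\<Lambda> (src G b))
        (comp_morph (\<Lambda> (src G b)) (X a) (X b)) (X (cmp G a b)) (\<theta> a b)"
    and "\<And>g x. \<lbrakk>g \<in> paths G; x \<in> elts (X g)\<rbrakk> \<Longrightarrow> \<theta> (rng G g) g (mrng (X g) x, x) = x"
    and "\<And>a b c x y z. \<lbrakk>a \<in> paths G; b \<in> paths G; c \<in> paths G; src G a = rng G b; src G b = rng G c;
        x \<in> elts (X a); y \<in> elts (X b); z \<in> elts (X c);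
        msrc (X a) x = mrng (X b) y; msrc (X b) y = mrng (X c) z\<rbrakk> \<Longrightarrow>
      \<theta> (cmp G a b) c (\<theta> a b (x, y), z) = \<theta> a (cmp G b c) (x, \<theta> b c (y, z))"
  using assms unfolding is_system_def by blast+

section \<open>Building and comparing systems from data on edges\<close>

context one_graph
begin

text \<open>The isomorphisms with an edge on the left can be chosen independently of one another,
  because freeness of the path category leaves no relation between them to check.\<close>

lemma extend_to_system:
  fixes \<Lambda> :: "'g \<Rightarrow> 'u kgraph" and M :: "'g \<Rightarrow> ('u, 'u, 'u) morph"
  assumes kg: "\<And>v. v \<in> verts G \<Longrightarrow> is_kgraph k (\<Lambda> v)"
    and M: "\<And>g. g \<in> paths G \<Longrightarrow> is_morph (\<Lambda> (rng G g)) (\<Lambda> (src G g)) (M g)"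
    and Mv: "\<And>v. v \<in> verts G \<Longrightarrow> M v = id_morph (\<Lambda> v)"
    and prod: "\<And>e a. \<lbrakk>e \<in> edges G; a \<in> paths G; src G e = rng G a\<rbrakk> \<Longrightarrow>
      morph_isomorphic (\<Lambda> (rng G e)) (\<Lambda> (src G a))
        (comp_morph (\<Lambda> (src G a)) (M e) (M a)) (M (cmp G e a))"
  shows "\<exists>\<theta>. is_system 1 k G \<Lambda> M \<theta>"
proof -
  note K = kgraphD[OF G]
  let ?C = "\<lambda>a b. comp_morph (\<Lambda> (src G b)) (M a) (M b)"
  let ?iso = "\<lambda>a b. is_morph_iso (\<Lambda> (rng G a)) (\<Lambda> (src G b)) (?C a b) (M (cmp G a b))"
  have "\<exists>t. ?iso e a t \<and> (a \<in> verts G \<longrightarrow> t = fst)"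
    if "e \<in> edges G" "a \<in> paths G" "src G e = rng G a" for e a
  proof (cases "a \<in> verts G")
    \<comment> \<open>Here \<open>M a\<close> is an identity morph and \<open>cmp G e a = e\<close>,
      so the first projection is the canonical choice.\<close>
    case True
    then have a: "src G e = a" "src G a = a" "cmp G e a = e"
      using K(2)[of a] K(4)[of e] that edgesD by auto
    have "is_morph_iso (\<Lambda> (rng G e)) (\<Lambda> a) (comp_morph (\<Lambda> a) (M e) (id_morph (\<Lambda> a))) (M e) fst"
      using iso_id_right[OF kg[OF True]] M[of e] a that edgesD by metis
    then show ?thesis using a Mv True by auto
  next
    case False
    then show ?thesis using prod[OF that] by (auto simp: morph_isomorphic_def)
  qed
  then obtain \<tau> where \<tau>: "\<And>e a. \<lbrakk>e \<in> edges G; a \<in> paths G; src G e = rng G a\<rbrakk> \<Longrightarrow> ?iso e a (\<tau> e a)"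
    and \<tau>v: "\<And>e v. \<lbrakk>e \<in> edges G; v \<in> verts G; src G e = v\<rbrakk> \<Longrightarrow> \<tau> e v = fst"
    using K(2) by metis
  \<comment> \<open>Right to left: undo \<open>\<tau> e a\<close>, rebracket, multiply the last two
    factors by \<open>\<theta> a b\<close>, then apply \<open>\<tau> e (cmp G a b)\<close>. The
    recursion runs over the first path and keeps \<open>b\<close> as an argument.\<close>
  obtain \<theta> :: "'g \<Rightarrow> 'g \<Rightarrow> 'u \<times> 'u \<Rightarrow> 'u" where \<theta>v: "\<And>v. v \<in> verts G \<Longrightarrow> \<theta> v = (\<lambda>b. snd)"
    and \<theta>e: "\<And>e a. \<lbrakk>e \<in> edges G; a \<in> paths G; src G e = rng G a\<rbrakk> \<Longrightarrow>
      \<theta> (cmp G e a) = (\<lambda>b. \<tau> e (cmp G a b) \<circ> (map_prod id (\<theta> a b) \<circ>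
        (assoc \<circ> map_prod (inv_into (elts (?C e a)) (\<tau> e a)) id)))"
    by (rule path_recursion[of "\<lambda>v b. snd" "\<lambda>e a f b. \<tau> e (cmp G a b) \<circ> (map_prod id (f b) \<circ>
        (assoc \<circ> map_prod (inv_into (elts (?C e a)) (\<tau> e a)) id))"]) blast
  \<comment> \<open>Vertices use the left unit isomorphism; in the inductive step each of the four
    composed maps is an isomorphism of morphs.\<close>
  have iso: "\<forall>b\<in>paths G. src G a = rng G b \<longrightarrow> ?iso a b (\<theta> a b)" if "a \<in> paths G" for a
    using that
  proof (induction rule: path_induct)
    case (vert v)
    show ?case
    proof (intro ballI impI)
      fix b assume b: "b \<in> paths G" "src G v = rng G b"
      have v: "rng G v = v" "rng G b = v" "cmp G v b = b" using K(2)[OF vert] K(4)[OF b(1)] b by auto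
      have "is_morph_iso (\<Lambda> v) (\<Lambda> (src G b)) (comp_morph (\<Lambda> (src G b)) (id_morph (\<Lambda> v)) (M b)) (M b) snd"
        using iso_id_left[OF kg kg] M[OF b(1)] vert v K(1)[OF b(1)] by metis
      then show "?iso v b (\<theta> v b)" using v vert by (simp add: Mv \<theta>v)
    qed
  next
    case (cmp e a)
    show ?case
    proof (intro ballI impI)
      fix b assume b: "b \<in> paths G" "src G (cmp G e a) = rng G b"
      note e = edgesD[OF cmp(1)]
      note ea = K(3)[OF e cmp(2,3)]
      have ab: "src G a = rng G b" using b ea by simp
      note ab' = K(3)[OF cmp(2) b(1) ab]
      have s: "is_kgraph k (\<Lambda> (src G a))" "is_kgraph k (\<Lambda> (src G b))"
        using kg K(1) cmp b by auto
      have mb: "is_morph (\<Lambda> (src G a)) (\<Lambda> (src G b)) (M b)"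
        and ma: "is_morph (\<Lambda> (src G e)) (\<Lambda> (src G a)) (M a)"
        using M[OF b(1)] M[OF cmp(2)] ab cmp(3) by simp_all
      have 1: "is_morph_iso (\<Lambda> (rng G e)) (\<Lambda> (src G a)) (M (cmp G e a)) (?C e a)
          (inv_into (elts (?C e a)) (\<tau> e a))"
        by (rule iso_sym[OF \<tau>[OF cmp(1-3)]])
      note 2 = iso_comp[OF s(2) 1 iso_refl[OF mb]]
      note 3 = iso_assoc[OF s(1,2) M[OF e] ma mb]
      have "is_morph_iso (\<Lambda> (src G e)) (\<Lambda> (src G b)) (?C a b) (M (cmp G a b)) (\<theta> a b)"
        using cmp(3,4) b(1) ab by simp
      note 4 = iso_comp[OF s(2) iso_refl[OF M[OF e]] this]
      have 5: "is_morph_iso (\<Lambda> (rng G e)) (\<Lambda> (src G b)) (comp_morph (\<Lambda> (src G b)) (M e) (M (cmp G a b)))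
          (M (cmp G e (cmp G a b))) (\<tau> e (cmp G a b))"
        using \<tau>[OF cmp(1), of "cmp G a b"] ab' cmp(3) by simp
      show "?iso (cmp G e a) b (\<theta> (cmp G e a) b)"
        using iso_trans[OF iso_trans[OF iso_trans[OF 2 3] 4] 5] ea K(5)[OF e cmp(2) b(1) cmp(3) ab]
        by (simp add: \<theta>e[OF cmp(1-3)])
    qed
  qed
  \<comment> \<open>The recursion with the inverse cancelled; the inductive steps of
    \<open>unit\<close> and \<open>assoc_law\<close> use it in this form.\<close>
  have step: "\<theta> (cmp G e a) b (\<tau> e a p, y) = \<tau> e (cmp G a b) (fst p, \<theta> a b (snd p, y))"
    if "e \<in> edges G" "a \<in> paths G" "src G e = rng G a" "p \<in> elts (?C e a)" for e a b p y
    using that is_morph_isoD(3)[OF \<tau>[OF that(1-3)]]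
    by (cases p) (simp add: \<theta>e bij_betw_inv_into_left)
  \<comment> \<open>Surjectivity of \<open>\<tau> e a\<close> brings every element into the form
    that \<open>step\<close> handles.\<close>
  have ex: "\<exists>x1 x2. x = \<tau> e a (x1, x2) \<and> (x1, x2) \<in> elts (?C e a) \<and> x1 \<in> elts (M e) \<and> x2 \<in> elts (M a) \<and>
      msrc (M e) x1 = mrng (M a) x2 \<and> msrc (M (cmp G e a)) x = msrc (M a) x2"
    if "e \<in> edges G" "a \<in> paths G" "src G e = rng G a" "x \<in> elts (M (cmp G e a))" for e a x
  proof -
    note t = is_morph_isoD[OF \<tau>[OF that(1-3)]]
    from that(4) obtain x1 x2 where x: "x = \<tau> e a (x1, x2)" "(x1, x2) \<in> elts (?C e a)"
      using t(3) unfolding bij_betw_def by force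
    then show ?thesis using t(6)[OF x(2)] by (auto simp: comp_elts_iff comp_simps(3))
  qed
  \<comment> \<open>This is the right unit law; the left one is built into
    \<open>\<theta> v = (\<lambda>b. snd)\<close>.\<close>
  have unit: "\<forall>x\<in>elts (M a). \<theta> a (src G a) (x, msrc (M a) x) = x" if "a \<in> paths G" for a
    using that
  proof (induction rule: path_induct)
    case (vert v)
    then show ?case by (simp add: Mv \<theta>v id_morph_simps)
  next
    case (cmp e a)
    have s: "src G (cmp G e a) = src G a" "cmp G a (src G a) = a"
      using K(3)[OF edgesD[OF cmp(1)] cmp(2,3)] K(4)[OF cmp(2)] by auto
    show ?case
    proof
      fix x assume "x \<in> elts (M (cmp G e a))"
      from ex[OF cmp(1-3) this] step[OF cmp(1-3)] cmp(4) s
      show "\<theta> (cmp G e a) (src G (cmp G e a)) (x, msrc (M (cmp G e a)) x) = x" by auto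
    qed
  qed
  have assoc_law: "\<forall>b\<in>paths G. \<forall>c\<in>paths G. src G a = rng G b \<and> src G b = rng G c \<longrightarrow>
     (\<forall>x\<in>elts (M a). \<forall>y\<in>elts (M b). \<forall>z\<in>elts (M c).
        msrc (M a) x = mrng (M b) y \<and> msrc (M b) y = mrng (M c) z \<longrightarrow>
        \<theta> (cmp G a b) c (\<theta> a b (x, y), z) = \<theta> a (cmp G b c) (x, \<theta> b c (y, z)))"
    if "a \<in> paths G" for a
    using that
  proof (induction rule: path_induct)
    case (vert v)
    have "cmp G v b = b" if "b \<in> paths G" "src G v = rng G b" for b
      using K(2)[OF vert] K(4)[OF that(1)] that by simp
    \<comment> \<open>At a vertex both sides reduce to \<open>\<theta> b c (y, z)\<close>.\<close>
    then show ?case by (simp add: \<theta>v[OF vert])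
  next
    case (cmp e a)
    note e = edgesD[OF cmp(1)]
    note ea = K(3)[OF e cmp(2,3)]
    show ?case
    proof (intro ballI impI, elim conjE)
      fix b c x y z
      assume b: "b \<in> paths G" and c: "c \<in> paths G" and eab: "src G (cmp G e a) = rng G b"
        and bc: "src G b = rng G c" and x: "x \<in> elts (M (cmp G e a))" and y: "y \<in> elts (M b)"
        and z: "z \<in> elts (M c)" and xy: "msrc (M (cmp G e a)) x = mrng (M b) y"
        and yz: "msrc (M b) y = mrng (M c) z"
      have ab: "src G a = rng G b" using eab ea by simp
      note ab' = K(3)[OF cmp(2) b ab]
      obtain x1 x2 where x': "x = \<tau> e a (x1, x2)" "(x1, x2) \<in> elts (?C e a)" "x1 \<in> elts (M e)"
        "x2 \<in> elts (M a)" "msrc (M e) x1 = mrng (M a) x2" "msrc (M a) x2 = mrng (M b) y"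
        using ex[OF cmp(1-3) x] xy by auto
      note i = is_morph_isoD[OF iso[rule_format, OF cmp(2) b ab]]
      have xy': "(x2, y) \<in> elts (?C a b)" using x' y by (simp add: comp_elts_iff)
      \<comment> \<open>Membership needed to use \<open>step\<close> again with
        \<open>cmp G a b\<close> in the role of \<open>a\<close>.\<close>
      have p: "(x1, \<theta> a b (x2, y)) \<in> elts (?C e (cmp G a b))"
        using x' y i(4,5)[OF xy'] by (simp add: comp_elts_iff comp_simps(2))
      have eab': "src G e = rng G (cmp G a b)" using ab' cmp(3) by simp
      \<comment> \<open>Pull the edge out of both products, apply the induction hypothesis inside
        \<open>\<tau> e\<close>, then use the recursion backwards.\<close>
      have "\<theta> (cmp G (cmp G e a) b) c (\<theta> (cmp G e a) b (x, y), z)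
          = \<theta> (cmp G e (cmp G a b)) c (\<tau> e (cmp G a b) (x1, \<theta> a b (x2, y)), z)"
        using step[OF cmp(1-3) x'(2)] x'(1) K(5)[OF e cmp(2) b cmp(3) ab] by simp
      also have "\<dots> = \<tau> e (cmp G (cmp G a b) c) (x1, \<theta> (cmp G a b) c (\<theta> a b (x2, y), z))"
        using step[OF cmp(1) _ eab' p] ab' by simp
      also have "\<dots> = \<tau> e (cmp G a (cmp G b c)) (x1, \<theta> a (cmp G b c) (x2, \<theta> b c (y, z)))"
        using cmp(4) b c ab bc x' y z yz K(5)[OF cmp(2) b c ab bc] by simp
      also have "\<dots> = \<theta> (cmp G e a) (cmp G b c) (x, \<theta> b c (y, z))"
        using step[OF cmp(1-3) x'(2)] x'(1) by simp
      finally show "\<theta> (cmp G (cmp G e a) b) c (\<theta> (cmp G e a) b (x, y), z)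
        = \<theta> (cmp G e a) (cmp G b c) (x, \<theta> b c (y, z))" .
    qed
  qed
  have "is_system 1 k G \<Lambda> M \<theta>"
    unfolding is_system_def
    using G kg M Mv iso unit assoc_law \<theta>v K(1) by simp
  then show ?thesis by blast
qed

text \<open>Each element over \<open>cmp G e a\<close> is a unique product under
  \<open>\<theta> e a\<close>, so maps chosen on edges, with no compatibility required, extend to
  all paths.\<close>

lemma system_iso_of_edges:
  fixes X Y :: "'g \<Rightarrow> ('u, 'u, 'u) morph"
  assumes X: "is_system 1 k G \<Lambda> X \<theta>" and Y: "is_system 1 k G \<Xi> Y \<psi>"
    and eq: "\<And>v. v \<in> verts G \<Longrightarrow> \<Xi> v = \<Lambda> v"
    and ed: "\<And>e. e \<in> edges G \<Longrightarrow> morph_isomorphic (\<Lambda> (rng G e)) (\<Lambda> (src G e)) (X e) (Y e)"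
  shows "\<exists>h0 h. is_system_iso G \<Lambda> X \<theta> \<Xi> Y \<psi> h0 h"
proof -
  note K = kgraphD[OF G]
  note X' = systemD[OF X] and Y' = systemD[OF Y]
  have eqp: "\<Xi> (src G g) = \<Lambda> (src G g)" "\<Xi> (rng G g) = \<Lambda> (rng G g)" if "g \<in> paths G" for g
    using that K(1) eq by auto
  let ?C = "\<lambda>a b. comp_morph (\<Lambda> (src G b)) (X a) (X b)"
  obtain j where j: "\<And>e. e \<in> edges G \<Longrightarrow>
      is_morph_iso (\<Lambda> (rng G e)) (\<Lambda> (src G e)) (X e) (Y e) (j e)"
    using ed unfolding morph_isomorphic_def by metis
  \<comment> \<open>Right to left: split by the inverse of \<open>\<theta> e a\<close>, map the
    factors by \<open>j e\<close> and \<open>h a\<close>, and recombine in \<open>Y\<close> by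
    \<open>\<psi> e a\<close>.\<close>
  obtain h :: "'g \<Rightarrow> 'u \<Rightarrow> 'u" where hv: "\<And>v. v \<in> verts G \<Longrightarrow> h v = id"
    and he: "\<And>e a. \<lbrakk>e \<in> edges G; a \<in> paths G; src G e = rng G a\<rbrakk> \<Longrightarrow>
      h (cmp G e a) = \<psi> e a \<circ> (map_prod (j e) (h a) \<circ> inv_into (elts (?C e a)) (\<theta> e a))"
    by (rule path_recursion[of "\<lambda>v. id"
      "\<lambda>e a f. \<psi> e a \<circ> (map_prod (j e) f \<circ> inv_into (elts (?C e a)) (\<theta> e a))"]) blast
  have iso: "is_morph_iso (\<Lambda> (rng G g)) (\<Lambda> (src G g)) (X g) (Y g) (h g)" if "g \<in> paths G" for g
    using that
  proof (induction rule: path_induct)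
    case (vert v)
    have "is_morph_iso (\<Lambda> v) (\<Lambda> v) (id_morph (\<Lambda> v)) (id_morph (\<Lambda> v)) id"
      by (rule iso_refl[OF is_morph_id[OF X'(1)[OF vert]]])
    then show ?case using vert K(2)[OF vert] X'(2) Y'(2) eq hv by (simp add: id_def)
  next
    case (cmp e a)
    note e = edgesD[OF cmp(1)]
    note ea = K(3)[OF e cmp(2,3)]
    note 1 = iso_sym[OF X'(4)[OF e cmp(2,3)]]
    have s: "is_kgraph k (\<Lambda> (src G a))" using X'(1) K(1) cmp(2) by auto
    have ja: "is_morph_iso (\<Lambda> (src G e)) (\<Lambda> (src G a)) (X a) (Y a) (h a)"
      using cmp(3,4) by simp
    note 2 = iso_comp[OF s j[OF cmp(1)] ja]
    have 3: "is_morph_iso (\<Lambda> (rng G e)) (\<Lambda> (src G a)) (comp_morph (\<Lambda> (src G a)) (Y e) (Y a))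
        (Y (cmp G e a)) (\<psi> e a)"
      using Y'(4)[OF e cmp(2,3)] eqp e cmp(2) by simp
    show ?case
      using iso_trans[OF iso_trans[OF 1 2] 3] ea by (simp add: he[OF cmp(1-3)] o_def)
  qed
  have step: "h (cmp G e a) (\<theta> e a (x, y)) = \<psi> e a (j e x, h a y)"
    if "e \<in> edges G" "a \<in> paths G" "src G e = rng G a" "(x, y) \<in> elts (?C e a)" for e a x y
    using that is_morph_isoD(3)[OF X'(4)[OF edgesD[OF that(1)] that(2,3)]]
    by (simp add: he bij_betw_inv_into_left)
  have mult: "\<forall>b\<in>paths G. src G a = rng G b \<longrightarrow> (\<forall>x\<in>elts (X a). \<forall>y\<in>elts (X b).
      msrc (X a) x = mrng (X b) y \<longrightarrow> h (cmp G a b) (\<theta> a b (x, y)) = \<psi> a b (h a x, h b y))"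
    if "a \<in> paths G" for a
    using that
  proof (induction rule: path_induct)
    case (vert v)
    show ?case
    proof (intro ballI impI)
      fix b x y assume b: "b \<in> paths G" "src G v = rng G b" and x: "x \<in> elts (X v)"
        and y: "y \<in> elts (X b)" and xy: "msrc (X v) x = mrng (X b) y"
      have v: "rng G b = v" "cmp G v b = b" using K(2)[OF vert] K(4)[OF b(1)] b by auto
      have x': "x = mrng (X b) y" using x xy by (simp add: X'(2)[OF vert] id_morph_simps)
      note i = is_morph_isoD[OF iso[OF b(1)]]
      \<comment> \<open>\<open>x\<close> is forced to be \<open>mrng (X b) y\<close>, and
        \<open>h b\<close> preserves ranges, so the left unit laws of both systems apply.\<close>
      have "\<psi> v b (x, h b y) = h b y"
        using Y'(5)[OF b(1) i(4)[OF y]] i(5)[OF y] v x' by simp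
      moreover have "\<theta> v b (x, y) = y" using X'(5)[OF b(1) y] v x' by simp
      ultimately show "h (cmp G v b) (\<theta> v b (x, y)) = \<psi> v b (h v x, h b y)"
        using v vert by (simp add: hv)
    qed
  next
    case (cmp e a)
    note e = edgesD[OF cmp(1)]
    note ea = K(3)[OF e cmp(2,3)]
    note t = is_morph_isoD[OF X'(4)[OF e cmp(2,3)]]
    note je = is_morph_isoD[OF j[OF cmp(1)]] and ha = is_morph_isoD[OF iso[OF cmp(2)]]
    show ?case
    proof (intro ballI impI)
      fix b x y assume b: "b \<in> paths G" "src G (cmp G e a) = rng G b" and x: "x \<in> elts (X (cmp G e a))"
        and y: "y \<in> elts (X b)" and xy: "msrc (X (cmp G e a)) x = mrng (X b) y"
      have ab: "src G a = rng G b" using b ea by simp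
      note ab' = K(3)[OF cmp(2) b(1) ab]
      have eab': "src G e = rng G (cmp G a b)" using ab' cmp(3) by simp
      obtain x1 x2 where x': "x = \<theta> e a (x1, x2)" "(x1, x2) \<in> elts (?C e a)"
        using t(3) x unfolding bij_betw_def by force
      have x12: "x1 \<in> elts (X e)" "x2 \<in> elts (X a)" "msrc (X e) x1 = mrng (X a) x2"
        using x' by (simp_all add: comp_elts_iff)
      have x2: "msrc (X a) x2 = mrng (X b) y"
        using t(6)[OF x'(2)] x'(1) xy x12 by (simp add: comp_simps(3))
      have xy': "(x2, y) \<in> elts (?C a b)" using x12 y x2 by (simp add: comp_elts_iff)
      note i = is_morph_isoD[OF X'(4)[OF cmp(2) b(1) ab]]
      note hb = is_morph_isoD[OF iso[OF b(1)]]
      have p: "(x1, \<theta> a b (x2, y)) \<in> elts (?C e (cmp G a b))"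
        using x12 x2 y i(4,5)[OF xy'] by (simp add: comp_elts_iff comp_simps(2))
      \<comment> \<open>Associativity in \<open>X\<close> moves the edge outside,
        \<open>step\<close> and the induction hypothesis carry \<open>h\<close> inward, and
        associativity in \<open>Y\<close> regroups the result.\<close>
      have "h (cmp G (cmp G e a) b) (\<theta> (cmp G e a) b (x, y))
          = h (cmp G e (cmp G a b)) (\<theta> e (cmp G a b) (x1, \<theta> a b (x2, y)))"
        using X'(6)[OF e cmp(2) b(1) cmp(3) ab x12(1,2) y x12(3) x2] x'(1)
          K(5)[OF e cmp(2) b(1) cmp(3) ab] by simp
      also have "\<dots> = \<psi> e (cmp G a b) (j e x1, h (cmp G a b) (\<theta> a b (x2, y)))"
        using step[OF cmp(1) _ eab' p] ab' by simp
      also have "\<dots> = \<psi> e (cmp G a b) (j e x1, \<psi> a b (h a x2, h b y))"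
        using cmp(4) b(1) ab x12 y x2 by simp
      also have "\<dots> = \<psi> (cmp G e a) b (\<psi> e a (j e x1, h a x2), h b y)"
        using Y'(6)[OF e cmp(2) b(1) cmp(3) ab je(4)[OF x12(1)] ha(4)[OF x12(2)] hb(4)[OF y]]
          je(6)[OF x12(1)] ha(5,6)[OF x12(2)] hb(5)[OF y] x12 x2 by simp
      also have "\<dots> = \<psi> (cmp G e a) b (h (cmp G e a) x, h b y)"
        using step[OF cmp(1-3) x'(2)] x'(1) by simp
      finally show "h (cmp G (cmp G e a) b) (\<theta> (cmp G e a) b (x, y))
        = \<psi> (cmp G e a) b (h (cmp G e a) x, h b y)" .
    qed
  qed
  \<comment> \<open>The \<open>k\<close>-graphs at each vertex are equal by \<open>eq\<close>, so
    \<open>h0\<close> can be the identity.\<close>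
  have "is_system_iso G \<Lambda> X \<theta> \<Xi> Y \<psi> (\<lambda>_. id) h"
    unfolding is_system_iso_def
  proof (intro conjI ballI impI)
    show "is_kgraph_iso (\<Lambda> v) (\<Xi> v) id" if "v \<in> verts G" for v
      using is_kgraph_iso_id[OF X'(1)[OF that]] eq that by simp
    show "h (cmp G a b) (\<theta> a b p) = \<psi> a b (map_prod (h a) (h b) p)"
      if "a \<in> paths G" "b \<in> paths G" "src G a = rng G b"
        "p \<in> fprod (elts (X a)) (msrc (X a)) (elts (X b)) (mrng (X b))" for a b p
      using mult that by (auto simp: fprod_def)
  qed (use iso in \<open>auto simp: is_morph_iso_def\<close>)
  then show ?thesis by blast
qed

text \<open>Functoriality on products with an edge on the left supplies the isomorphisms that
  \<open>extend_to_system\<close> asks for.\<close>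

lemma system_of_functor:
  fixes F0 :: "'g \<Rightarrow> 'u kgraph" and F :: "'g \<Rightarrow> 'u mor"
  assumes F: "is_functor (kcat G) (Mcat k) F0 F"
  shows "\<exists>X \<theta>. is_system 1 k G F0 X \<theta> \<and>
    (\<forall>g\<in>paths G. F g = mclass (F0 (rng G g)) (F0 (src G g)) (X g))"
proof -
  note K = kgraphD[OF G]
  have kg: "is_kgraph k (F0 v)" if "v \<in> verts G" for v
    using F that by (simp add: is_functor_def kcat_def Mcat_def)
  have Fv: "F v = mclass (F0 v) (F0 v) (id_morph (F0 v))" if "v \<in> verts G" for v
    using F that by (simp add: is_functor_def kcat_def Mcat_def)
  have Fc: "F (cmp G a b) = mcomp (F a) (F b)"
    if "a \<in> paths G" "b \<in> paths G" "src G a = rng G b" for a b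
    using F that by (simp add: is_functor_def kcat_def Mcat_def)
  \<comment> \<open>At a vertex the representative must be the identity morph itself, since a system
    demands equality there and not just isomorphism.\<close>
  have "\<exists>X. is_morph (F0 (rng G g)) (F0 (src G g)) X \<and>
      F g = mclass (F0 (rng G g)) (F0 (src G g)) X \<and> (g \<in> verts G \<longrightarrow> X = id_morph (F0 g))"
    if g: "g \<in> paths G" for g
  proof (cases "g \<in> verts G")
    case True
    then show ?thesis using K(2)[OF True] Fv is_morph_id kg by auto
  next
    case False
    \<comment> \<open>An arrow records its ends, which identifies the unknown
      \<open>k\<close>-graphs in \<open>MHom\<close> with those given by \<open>F0\<close>.\<close>
    have "mdom (F g) = F0 (src G g)" "mcod (F g) = F0 (rng G g)"
      "\<exists>\<Lambda> \<Gamma>. F g \<in> MHom \<Gamma> \<Lambda>"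
      using F g unfolding is_functor_def kcat_def Mcat_def by simp_all blast+
    then show ?thesis using False by (auto simp: MHom_def mclass_def)
  qed
  then obtain M where M: "\<And>g. g \<in> paths G \<Longrightarrow> is_morph (F0 (rng G g)) (F0 (src G g)) (M g)"
    and FM: "\<And>g. g \<in> paths G \<Longrightarrow> F g = mclass (F0 (rng G g)) (F0 (src G g)) (M g)"
    and Mv: "\<And>v. v \<in> verts G \<Longrightarrow> M v = id_morph (F0 v)"
    using K(2) by metis
  have "morph_isomorphic (F0 (rng G e)) (F0 (src G a))
      (comp_morph (F0 (src G a)) (M e) (M a)) (M (cmp G e a))"
    if "e \<in> edges G" "a \<in> paths G" "src G e = rng G a" for e a
  proof (rule mclass_eqD)
    note e = edgesD[OF that(1)]
    note ea = K(3)[OF e that(2,3)]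
    show "is_morph (F0 (rng G e)) (F0 (src G a)) (M (cmp G e a))"
      using M[of "cmp G e a"] ea by simp
    have s: "is_kgraph k (F0 (src G a))" using kg K(1) that(2) by simp
    have ma: "is_morph (F0 (src G e)) (F0 (src G a)) (M a)" using M[OF that(2)] that(3) by simp
    \<comment> \<open>Both sides are \<open>F (cmp G e a)\<close>; the left one computes
      \<open>mcomp (F e) (F a)\<close> on representatives.\<close>
    show "mclass (F0 (rng G e)) (F0 (src G a)) (comp_morph (F0 (src G a)) (M e) (M a)) =
        mclass (F0 (rng G e)) (F0 (src G a)) (M (cmp G e a))"
      using mcomp_mclass[OF s M[OF e] ma] Fc[OF e that(2,3)] FM[of "cmp G e a"] FM[OF e] FM[OF that(2)]
        ea that(3) by simp
  qed
  then obtain \<theta> where "is_system 1 k G F0 M \<theta>"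
    using extend_to_system[of k F0 M] kg M Mv by blast
  then show ?thesis using FM by blast
qed

end

theorem proposition5p14:
  fixes k :: nat
    and \<Gamma> :: "'g kgraph"
    and F0 :: "'g \<Rightarrow> 'u kgraph"
    and F :: "'g \<Rightarrow> 'u mor"
  assumes "is_kgraph 1 \<Gamma>"
    and "is_functor (kcat \<Gamma>) (Mcat k) F0 F"
  shows
    "(\<exists>\<Lambda> X \<theta>. is_system 1 k \<Gamma> \<Lambda> X \<theta> \<and>
        (\<forall>v\<in>verts \<Gamma>. F0 v = \<Lambda> v) \<and>
        (\<forall>g\<in>paths \<Gamma>. F g = mclass (\<Lambda> (rng \<Gamma> g)) (\<Lambda> (src \<Gamma> g)) (X g))) \<and>
     (\<forall>\<Lambda> X \<theta> \<Xi> Y \<psi>.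
        is_system 1 k \<Gamma> \<Lambda> X \<theta> \<and>
        (\<forall>v\<in>verts \<Gamma>. F0 v = \<Lambda> v) \<and>
        (\<forall>g\<in>paths \<Gamma>. F g = mclass (\<Lambda> (rng \<Gamma> g)) (\<Lambda> (src \<Gamma> g)) (X g)) \<and>
        is_system 1 k \<Gamma> \<Xi> Y \<psi> \<and>
        (\<forall>v\<in>verts \<Gamma>. F0 v = \<Xi> v) \<and>
        (\<forall>g\<in>paths \<Gamma>. F g = mclass (\<Xi> (rng \<Gamma> g)) (\<Xi> (src \<Gamma> g)) (Y g)) \<longrightarrow>
        (\<exists>h0 h. is_system_iso \<Gamma> \<Lambda> X \<theta> \<Xi> Y \<psi> h0 h))"
proof -
  interpret one_graph \<Gamma> using assms(1) by unfold_locales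
  note K = kgraphD[OF assms(1)]
  have "\<exists>h0 h. is_system_iso \<Gamma> \<Lambda> X \<theta> \<Xi> Y \<psi> h0 h"
    if X: "is_system 1 k \<Gamma> \<Lambda> X \<theta>" and X0: "\<forall>v\<in>verts \<Gamma>. F0 v = \<Lambda> v"
      and FX: "\<forall>g\<in>paths \<Gamma>. F g = mclass (\<Lambda> (rng \<Gamma> g)) (\<Lambda> (src \<Gamma> g)) (X g)"
      and Y: "is_system 1 k \<Gamma> \<Xi> Y \<psi>" and Y0: "\<forall>v\<in>verts \<Gamma>. F0 v = \<Xi> v"
      and FY: "\<forall>g\<in>paths \<Gamma>. F g = mclass (\<Xi> (rng \<Gamma> g)) (\<Xi> (src \<Gamma> g)) (Y g)"
    for \<Lambda> :: "'g \<Rightarrow> 'u kgraph" and X \<theta> \<Xi> Y \<psi>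
  proof (rule system_iso_of_edges[OF X Y])
    show eq: "\<Xi> v = \<Lambda> v" if "v \<in> verts \<Gamma>" for v using X0 Y0 that by simp
    fix e assume "e \<in> edges \<Gamma>"
    then have e: "e \<in> paths \<Gamma>" by (rule edgesD)
    then have "\<Xi> (rng \<Gamma> e) = \<Lambda> (rng \<Gamma> e)" "\<Xi> (src \<Gamma> e) = \<Lambda> (src \<Gamma> e)" using eq K(1) by auto
    \<comment> \<open>\<open>X e\<close> and \<open>Y e\<close> both represent
      \<open>F e\<close>.\<close>
    then show "morph_isomorphic (\<Lambda> (rng \<Gamma> e)) (\<Lambda> (src \<Gamma> e)) (X e) (Y e)"
      using FX FY systemD(3)[OF Y e] e by (intro mclass_eqD) auto
  qed
  then show ?thesis using system_of_functor[OF assms(2)] by blast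
qed

end
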